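(* Let $\Bbbk$ be a field. Let $W$ be a Coxeter group with Coxeter matrix $M = (m_{ij})_{i,j \in I}$, $I$ finite, and suppose its Dynkin diagram (Coxeter graph) is connected. Fix an integer vector ${\bf d} = (d_i)_{i \in I}$ with $d_i \geqslant 2$ for all $i \in I$, and let $M({\bf d})$ be the generalized Coxeter matrix obtained from $M$ by replacing its diagonal by ${\bf d}$. The following are equivalent: \begin{enumerate} \item The generalized nil-Coxeter algebra $NC(M({\bf d}))$ is finite-dimensional over $\Bbbk$. \item Either $W$ is a finite Coxeter group and $d_i = 2$ for all $i \in I$, or $W$ is of type $A_n$ and ${\bf d} = (2,\dots,2,d)$ or ${\bf d} = (d,2,\dots,2)$ for some $d > 2$. \end{enumerate}
   Context: A Coxeter matrix is a symmetric matrix $M = (m_{ij})_{i,j \in I}$ with $I$ finite, $m_{ii} = 2$ for all $i$, and $m_{ij} \in \{2,3,\dots\} \cup \{\infty\}$ for $i \neq j$. The Coxeter group is $W = \langle s_i, i \in I \mid s_i^2 = 1,\ \underbrace{s_i s_j s_i \cdots}_{m_{ij}} = \underbrace{s_j s_i s_j \cdots}_{m_{ij}} \text{ for } i \neq j,\ m_{ij} < \infty \rangle$. Its Dynkin diagram (Coxeter graph) has vertex set $I$, with $i \neq j$ joined by an edge exactly when $m_{ij} \geqslant 3$. For an integer vector ${\bf d} = (d_i)_{i \in I}$ with $d_i \geqslant 2$, the generalized nil-Coxeter algebra $NC(M({\bf d}))$ is the unital associative $\Bbbk$-algebra with generators $T_i$, $i \in I$, and relations $$\underbrace{T_i T_j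 T_i \cdots}_{m_{ij}\text{ factors}} = \underbrace{T_j T_i T_j \cdots}_{m_{ij}\text{ factors}} \quad (i \neq j,\ m_{ij} < \infty), \qquad T_i^{d_i} = 0 \quad (i \in I)$$ (no braid relation is imposed for the pair $i,j$ if $m_{ij} = \infty$). $W$ is of type $A_n$ ($n \geqslant 1$) if $I$ can be identified with $\{1, \dots, n\}$ such that, for $i \neq j$, $m_{ij} = 3$ if $|i-j| = 1$ and $m_{ij} = 2$ otherwise; the coordinates of ${\bf d}$ are then listed in the order $1, \dots, n$ (so for $n=1$, ${\bf d} = (d)$). *)

theory Defs
  imports
    "HOL-Algebra.Embedded_Algebras"
    "HOL-Algebra.QuotRing"
    "HOL-Library.Poly_Mapping"
    "HOL-Library.Extended_Nat"
    "Graph_Theory.Graph_Theory"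
begin

(* otherwise it shadows the record field mult of monoids *)
hide_const (open) Multiset.mult

section \<open>Coxeter matrices and Coxeter graphs\<close>

text \<open>Matrices over the index set \<open>I\<close> are functions \<open>'i \<Rightarrow> 'i \<Rightarrow> enat\<close>; entries outside
  \<open>I \<times> I\<close> are irrelevant.\<close>

definition coxeter_matrix :: "'i set \<Rightarrow> ('i \<Rightarrow> 'i \<Rightarrow> enat) \<Rightarrow> bool" where
  "coxeter_matrix I m \<longleftrightarrow>
     finite I \<and>
     (\<forall>i\<in>I. \<forall>j\<in>I. m i j = m j i) \<and>
     (\<forall>i\<in>I. m i i = 2) \<and>
     (\<forall>i\<in>I. \<forall>j\<in>I. i \<noteq> j \<longrightarrow> 2 \<le> m i j)"

definition coxeter_graph :: "'i set \<Rightarrow> ('i \<Rightarrow> 'i \<Rightarrow> enat) \<Rightarrow> 'i pair_pre_digraph" where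
  "coxeter_graph I m =
     \<lparr>pverts = I, parcs = {(i, j). i \<in> I \<and> j \<in> I \<and> i \<noteq> j \<and> 3 \<le> m i j}\<rparr>"

definition replace_diagonal :: "('i \<Rightarrow> 'i \<Rightarrow> enat) \<Rightarrow> ('i \<Rightarrow> nat) \<Rightarrow> 'i \<Rightarrow> 'i \<Rightarrow> enat" where
  "replace_diagonal m d = (\<lambda>i j. if i = j then enat (d i) else m i j)"

text \<open>\<open>f\<close> is the identification of \<open>{1, \<dots>, n}\<close> with \<open>I\<close>.\<close>

definition type_A_labelling :: "'i set \<Rightarrow> ('i \<Rightarrow> 'i \<Rightarrow> enat) \<Rightarrow> nat \<Rightarrow> (nat \<Rightarrow> 'i) \<Rightarrow> bool" where
  "type_A_labelling I m n f \<longleftrightarrow>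
     bij_betw f {1..n} I \<and>
     (\<forall>a\<in>{1..n}. \<forall>b\<in>{1..n}. a \<noteq> b \<longrightarrow>
        m (f a) (f b) = (if \<bar>int a - int b\<bar> = 1 then 3 else 2))"

primrec alternating :: "nat \<Rightarrow> 'a \<Rightarrow> 'a \<Rightarrow> 'a list" where
  "alternating 0 x y = []"
| "alternating (Suc n) x y = x # alternating n y x"

lemma set_alternating: "set (alternating n x y) \<subseteq> {x, y}"
  by (induction n arbitrary: x y) auto

section \<open>Groups given by generators and relations\<close>

text \<open>A letter \<open>(a, True)\<close> stands for the generator \<open>a\<close>, a letter \<open>(a, False)\<close> for its formal
  inverse. A pair \<open>(u, v) \<in> R\<close> is the relation \<open>u = v\<close>. The rule \<open>cancel\<close> alone generates the
  congruence defining the free group on \<open>A\<close>.\<close>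

inductive presentation_cong ::
    "'a set \<Rightarrow> (('a \<times> bool) list \<times> ('a \<times> bool) list) set \<Rightarrow>
     ('a \<times> bool) list \<Rightarrow> ('a \<times> bool) list \<Rightarrow> bool"
  for A R where
  refl: "w \<in> lists (A \<times> UNIV) \<Longrightarrow> presentation_cong A R w w"
| sym: "presentation_cong A R u v \<Longrightarrow> presentation_cong A R v u"
| trans: "presentation_cong A R u v \<Longrightarrow> presentation_cong A R v w \<Longrightarrow> presentation_cong A R u w"
| append: "presentation_cong A R u u' \<Longrightarrow> presentation_cong A R v v' \<Longrightarrow>
     presentation_cong A R (u @ v) (u' @ v')"
| cancel: "a \<in> A \<Longrightarrow> presentation_cong A R [(a, b), (a, \<not> b)] []"
| relation: "(u, v) \<in> R \<Longrightarrow> u \<in> lists (A \<times> UNIV) \<Longrightarrow> v \<in> lists (A \<times> UNIV) \<Longrightarrow>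
     presentation_cong A R u v"

definition presented_group ::
    "'a set \<Rightarrow> (('a \<times> bool) list \<times> ('a \<times> bool) list) set \<Rightarrow> ('a \<times> bool) list set monoid" where
  "presented_group A R =
     \<lparr>carrier = lists (A \<times> UNIV) // {(u, v). presentation_cong A R u v},
      mult = (\<lambda>U V. {w. \<exists>u\<in>U. \<exists>v\<in>V. presentation_cong A R (u @ v) w}),
      one = {w. presentation_cong A R [] w}\<rparr>"

definition coxeter_relations ::
    "'i set \<Rightarrow> ('i \<Rightarrow> 'i \<Rightarrow> enat) \<Rightarrow> (('i \<times> bool) list \<times> ('i \<times> bool) list) set" where
  "coxeter_relations I m =
     {([(i, True), (i, True)], []) | i. i \<in> I} \<union>
     {(alternating n (i, True) (j, True), alternating n (j, True) (i, True)) | i j n.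
        i \<in> I \<and> j \<in> I \<and> i \<noteq> j \<and> m i j = enat n}"

definition coxeter_group :: "'i set \<Rightarrow> ('i \<Rightarrow> 'i \<Rightarrow> enat) \<Rightarrow> ('i \<times> bool) list set monoid" where
  "coxeter_group I m = presented_group I (coxeter_relations I m)"

lemma presentation_cong_lists:
  assumes "presentation_cong A R u v"
  shows "u \<in> lists (A \<times> UNIV)" and "v \<in> lists (A \<times> UNIV)"
  using assms by (induction) auto

lemma presentation_cong_inverse:
  assumes "w \<in> lists (A \<times> UNIV)"
  shows "presentation_cong A R (map (\<lambda>(a, b). (a, \<not> b)) (rev w) @ w) []"
  using assms
proof (induction w)
  case Nil
  then show ?case by (simp add: presentation_cong.refl)
next
  case (Cons x w)
  obtain a b where x: "x = (a, b)" by (cases x)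
  let ?r = "map (\<lambda>(a, b). (a, \<not> b)) (rev w)"
  from Cons.hyps x have a: "a \<in> A" and w: "w \<in> lists (A \<times> UNIV)" by auto
  then have r: "?r \<in> lists (A \<times> UNIV)" by auto
  have c: "presentation_cong A R [(a, \<not> b), (a, b)] []"
    using presentation_cong.cancel[OF a, of R "\<not> b"] by simp
  have "presentation_cong A R (?r @ ([(a, \<not> b), (a, b)] @ w)) (?r @ ([] @ w))"
    by (intro presentation_cong.append presentation_cong.refl c r w)
  then have "presentation_cong A R (?r @ ([(a, \<not> b), (a, b)] @ w)) []"
    using Cons.IH by (auto intro: presentation_cong.trans)
  then show ?case by (simp add: x)
qed

lemma group_presented_group: "group (presented_group A R)"
proof -
  let ?C = "presentation_cong A R" and ?G = "presented_group A R"
  define cls where "cls w = {v. ?C w v}" for w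
  note C = presentation_cong.refl presentation_cong.sym presentation_cong.trans
    presentation_cong.append
  have carr: "carrier ?G = cls ` lists (A \<times> UNIV)"
    by (auto simp: presented_group_def quotient_def cls_def)
  have cls_eq: "cls u = cls v" if "?C u v" for u v
    using that by (auto simp: cls_def intro: C)
  have mult: "cls u \<otimes>\<^bsub>?G\<^esub> cls v = cls (u @ v)"
    if u: "u \<in> lists (A \<times> UNIV)" and v: "v \<in> lists (A \<times> UNIV)" for u v
  proof -
    have "?C (u @ v) w" if "?C u u'" "?C v v'" "?C (u' @ v') w" for u' v' w
      using that by (blast intro: C)
    moreover have "\<exists>u'. ?C u u' \<and> (\<exists>v'. ?C v v' \<and> ?C (u' @ v') w)" if "?C (u @ v) w" for w
      using that u v by (blast intro: C)
    ultimately show ?thesis by (auto simp: presented_group_def cls_def)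
  qed
  have one: "\<one>\<^bsub>?G\<^esub> = cls []" by (simp add: presented_group_def cls_def)
  have lists_append: "u @ v \<in> lists (A \<times> UNIV)"
    if "u \<in> lists (A \<times> UNIV)" "v \<in> lists (A \<times> UNIV)" for u v
    using that by auto
  show ?thesis
  proof (rule groupI)
    fix x assume "x \<in> carrier ?G"
    then obtain w where w: "w \<in> lists (A \<times> UNIV)" and x: "x = cls w" by (auto simp: carr)
    let ?r = "map (\<lambda>(a, b). (a, \<not> b)) (rev w)"
    have r: "?r \<in> lists (A \<times> UNIV)" using w by auto
    have "cls ?r \<otimes>\<^bsub>?G\<^esub> x = \<one>\<^bsub>?G\<^esub>"
      unfolding x one mult[OF r w] by (rule cls_eq[OF presentation_cong_inverse[OF w]])
    then show "\<exists>y\<in>carrier ?G. y \<otimes>\<^bsub>?G\<^esub> x = \<one>\<^bsub>?G\<^esub>" using r unfolding carr by blast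
    show "\<one>\<^bsub>?G\<^esub> \<otimes>\<^bsub>?G\<^esub> x = x" using mult[of "[]" w] w by (simp add: x one)
  next
    fix x y assume "x \<in> carrier ?G" "y \<in> carrier ?G"
    then obtain u v where *: "u \<in> lists (A \<times> UNIV)" "v \<in> lists (A \<times> UNIV)"
      and "x = cls u" "y = cls v" by (auto simp: carr)
    then show "x \<otimes>\<^bsub>?G\<^esub> y \<in> carrier ?G" using lists_append[OF *] by (simp add: carr mult)
  next
    fix x y z assume "x \<in> carrier ?G" "y \<in> carrier ?G" "z \<in> carrier ?G"
    then obtain u v w where *: "u \<in> lists (A \<times> UNIV)" "v \<in> lists (A \<times> UNIV)"
      "w \<in> lists (A \<times> UNIV)" and "x = cls u" "y = cls v" "z = cls w" by (auto simp: carr)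
    then show "x \<otimes>\<^bsub>?G\<^esub> y \<otimes>\<^bsub>?G\<^esub> z = x \<otimes>\<^bsub>?G\<^esub> (y \<otimes>\<^bsub>?G\<^esub> z)"
      using lists_append[OF *(1,2)] lists_append[OF *(2,3)] by (simp add: mult del: in_lists_conv_set)
  qed (auto simp: one carr)
qed

section \<open>Free associative algebras\<close>

text \<open>The product of \<^typ>\<open>'a \<Rightarrow>\<^sub>0 'k\<close> is the convolution product for an additively written
  monoid of exponents, so the free monoid is written additively, although it is not commutative.\<close>

datatype 'i free_monoid = Word (letters: "'i list")

instantiation free_monoid :: (type) monoid_add
begin

definition zero_free_monoid :: "'a free_monoid" where
  "zero_free_monoid = Word []"

definition plus_free_monoid :: "'a free_monoid \<Rightarrow> 'a free_monoid \<Rightarrow> 'a free_monoid" where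
  "plus_free_monoid u v = Word (letters u @ letters v)"

instance
  by standard (simp_all add: zero_free_monoid_def plus_free_monoid_def)

end

definition free_algebra ::
    "'k::field itself \<Rightarrow> 'i set \<Rightarrow> ('i free_monoid \<Rightarrow>\<^sub>0 'k) ring" where
  "free_algebra k I =
     \<lparr>carrier = {p. \<forall>w\<in>Poly_Mapping.keys p. set (letters w) \<subseteq> I},
      mult = (*), one = 1, zero = 0, add = (+)\<rparr>"

definition word_monomial :: "'i list \<Rightarrow> 'i free_monoid \<Rightarrow>\<^sub>0 'k::field" where
  "word_monomial w = Poly_Mapping.single (Word w) 1"

lemma free_algebra_simps [simp]:
  "p \<in> carrier (free_algebra k I) \<longleftrightarrow> (\<forall>w\<in>Poly_Mapping.keys p. set (letters w) \<subseteq> I)"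
  "p \<otimes>\<^bsub>free_algebra k I\<^esub> q = p * q"
  "p \<oplus>\<^bsub>free_algebra k I\<^esub> q = p + q"
  "\<one>\<^bsub>free_algebra k I\<^esub> = 1"
  "\<zero>\<^bsub>free_algebra k I\<^esub> = 0"
  by (simp_all add: free_algebra_def)

lemma ring_free_algebra: "ring (free_algebra k I)"
proof (rule ringI)
  show "abelian_group (free_algebra k I)"
  proof (rule abelian_groupI)
    fix p assume "p \<in> carrier (free_algebra k I)"
    then show "\<exists>q\<in>carrier (free_algebra k I). q \<oplus>\<^bsub>free_algebra k I\<^esub> p = \<zero>\<^bsub>free_algebra k I\<^esub>"
      by (intro bexI[of _ "- p"]) simp_all
  qed (use Poly_Mapping.keys_add in \<open>fastforce simp: add_ac\<close>)+
  show "Group.monoid (free_algebra k I)"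
  proof (rule monoidI)
    fix p q assume pq: "p \<in> carrier (free_algebra k I)" "q \<in> carrier (free_algebra k I)"
    have "Poly_Mapping.keys (p * q) \<subseteq>
        {u + v | u v. u \<in> Poly_Mapping.keys p \<and> v \<in> Poly_Mapping.keys q}"
      by (rule keys_mult)
    then show "p \<otimes>\<^bsub>free_algebra k I\<^esub> q \<in> carrier (free_algebra k I)"
      using pq by (fastforce simp: plus_free_monoid_def)
  qed (auto simp: mult.assoc zero_free_monoid_def)
qed (simp_all add: distrib_right distrib_left)

section \<open>Generalized nil-Coxeter algebras\<close>

text \<open>Here \<open>m\<close> is a generalized Coxeter matrix, whose diagonal entries are the nilpotency
  exponents.\<close>

definition nil_coxeter_relations ::
    "'i set \<Rightarrow> ('i \<Rightarrow> 'i \<Rightarrow> enat) \<Rightarrow> ('i free_monoid \<Rightarrow>\<^sub>0 'k::field) set" where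
  "nil_coxeter_relations I m =
     {word_monomial (alternating n i j) - word_monomial (alternating n j i) | i j n.
        i \<in> I \<and> j \<in> I \<and> i \<noteq> j \<and> m i j = enat n} \<union>
     {word_monomial (replicate n i) | i n. i \<in> I \<and> m i i = enat n}"

definition nil_coxeter_ideal ::
    "'k::field itself \<Rightarrow> 'i set \<Rightarrow> ('i \<Rightarrow> 'i \<Rightarrow> enat) \<Rightarrow> ('i free_monoid \<Rightarrow>\<^sub>0 'k) set" where
  "nil_coxeter_ideal k I m = Idl\<^bsub>free_algebra k I\<^esub> (nil_coxeter_relations I m)"

definition nil_coxeter_algebra ::
    "'k::field itself \<Rightarrow> 'i set \<Rightarrow> ('i \<Rightarrow> 'i \<Rightarrow> enat) \<Rightarrow> ('i free_monoid \<Rightarrow>\<^sub>0 'k) set ring" where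
  "nil_coxeter_algebra k I m = free_algebra k I Quot nil_coxeter_ideal k I m"

text \<open>The image of the ground field under the unit map. The library's notion of dimension is
  relative to a subfield of the ring; see \<open>subfield_nil_coxeter_scalars\<close> below.\<close>

definition nil_coxeter_scalars ::
    "'k::field itself \<Rightarrow> 'i set \<Rightarrow> ('i \<Rightarrow> 'i \<Rightarrow> enat) \<Rightarrow> ('i free_monoid \<Rightarrow>\<^sub>0 'k) set set" where
  "nil_coxeter_scalars k I m =
     range (\<lambda>c::'k. nil_coxeter_ideal k I m +>\<^bsub>free_algebra k I\<^esub> Poly_Mapping.single 0 c)"

definition nil_coxeter_finite_dimensional ::
    "'k::field itself \<Rightarrow> 'i set \<Rightarrow> ('i \<Rightarrow> 'i \<Rightarrow> enat) \<Rightarrow> bool" where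
  "nil_coxeter_finite_dimensional k I m \<longleftrightarrow>
     ring.finite_dimension (nil_coxeter_algebra k I m)
       (nil_coxeter_scalars k I m) (carrier (nil_coxeter_algebra k I m))"

lemma nil_coxeter_relations_carrier: "nil_coxeter_relations I m \<subseteq> carrier (free_algebra k I)"
proof -
  have mono: "word_monomial w \<in> carrier (free_algebra k I)" if "set w \<subseteq> I" for w
    using that by (simp add: word_monomial_def)
  have diff: "p - q \<in> carrier (free_algebra k I)"
    if "p \<in> carrier (free_algebra k I)" "q \<in> carrier (free_algebra k I)" for p q
    using that keys_diff[of p q] by auto
  have alt: "set (alternating n i j) \<subseteq> I" if "i \<in> I" "j \<in> I" for n i j
    using set_alternating[of n i j] that by auto
  show ?thesis
    unfolding nil_coxeter_relations_def
    by (auto simp del: free_algebra_simps intro!: diff mono dest: alt[THEN subsetD, rotated 2])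
qed

lemma ideal_nil_coxeter_ideal: "ideal (nil_coxeter_ideal k I m) (free_algebra k I)"
  unfolding nil_coxeter_ideal_def
  by (rule ring.genideal_ideal[OF ring_free_algebra nil_coxeter_relations_carrier])

lemma ring_nil_coxeter_algebra: "ring (nil_coxeter_algebra k I m)"
  unfolding nil_coxeter_algebra_def
  by (rule ideal.quotient_is_ring[OF ideal_nil_coxeter_ideal])

lemma one_notin_nil_coxeter_ideal:
  assumes "\<forall>i\<in>I. \<forall>j\<in>I. m i j \<noteq> 0"
  shows "1 \<notin> nil_coxeter_ideal k I m"
proof -
  let ?F = "free_algebra k I" and ?c = "\<lambda>p. Poly_Mapping.lookup p (0 :: 'a free_monoid)"
  let ?J = "{p \<in> carrier ?F. ?c p = 0}"
  interpret F: ring ?F by (rule ring_free_algebra)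
  have times: "?c (p * q) = ?c p * ?c q" for p q :: "'a free_monoid \<Rightarrow>\<^sub>0 'b"
  proof -
    have zero: "(0 = u + v) \<longleftrightarrow> u = 0 \<and> v = 0" for u v :: "'a free_monoid"
      by (auto simp: zero_free_monoid_def plus_free_monoid_def free_monoid.expand)
    have "(\<Sum>v. Poly_Mapping.lookup q v when 0 = u + v) = (?c q when u = 0)"
      for u :: "'a free_monoid"
      by (cases "u = 0") (simp_all add: zero when_def)
    then show ?thesis
      by (simp add: times_poly_mapping.rep_eq prod_fun_def mult_when)
  qed
  have minus: "\<ominus>\<^bsub>?F\<^esub> p = - p" if "p \<in> carrier ?F" for p
    by (rule F.minus_equality) (use that in simp_all)
  have "ideal ?J ?F"
  proof (rule idealI)
    show "subgroup ?J (add_monoid ?F)"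
    proof (rule group.subgroupI[OF F.a_group])
      fix p assume p: "p \<in> ?J"
      then show "inv\<^bsub>add_monoid ?F\<^esub> p \<in> ?J"
        using minus[of p] by (simp add: a_inv_def)
    next
      fix p q assume "p \<in> ?J" "q \<in> ?J"
      then show "p \<otimes>\<^bsub>add_monoid ?F\<^esub> q \<in> ?J"
        using F.a_closed[of p q] by (simp add: lookup_add del: free_algebra_simps(1))
    qed (auto intro!: exI[of _ 0])
  next
    fix p q assume "p \<in> ?J" "q \<in> carrier ?F"
    then show "q \<otimes>\<^bsub>?F\<^esub> p \<in> ?J" "p \<otimes>\<^bsub>?F\<^esub> q \<in> ?J"
      using F.m_closed[of p q] F.m_closed[of q p] by (simp_all add: times del: free_algebra_simps(1))
  qed (rule F.ring_axioms)
  moreover have "nil_coxeter_relations I m \<subseteq> ?J"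
  proof -
    have mono: "?c (word_monomial w) = 0" if "w \<noteq> []" for w
      using that by (simp add: word_monomial_def zero_free_monoid_def lookup_single when_def)
    have alt: "alternating n i j \<noteq> []" if "n \<noteq> 0" for n and i j :: 'a
      using that by (cases n) simp_all
    have pos: "n \<noteq> 0" if "i \<in> I" "j \<in> I" "m i j = enat n" for i j n
      using assms that by (metis zero_enat_def)
    have "?c r = 0" if "r \<in> nil_coxeter_relations I m" for r
      using that unfolding nil_coxeter_relations_def
      by (auto simp: lookup_minus mono alt pos)
    then show ?thesis using nil_coxeter_relations_carrier[of I m k] by blast
  qed
  ultimately have "nil_coxeter_ideal k I m \<subseteq> ?J"
    unfolding nil_coxeter_ideal_def by (rule F.genideal_minimal)
  then show ?thesis by auto
qed

lemma subfield_nil_coxeter_scalars: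
  assumes "\<forall>i\<in>I. \<forall>j\<in>I. m i j \<noteq> 0"
  shows "subfield (nil_coxeter_scalars k I m) (nil_coxeter_algebra k I m)"
proof -
  let ?F = "free_algebra k I" and ?N = "nil_coxeter_algebra k I m" and ?J = "nil_coxeter_ideal k I m"
  let ?s = "Poly_Mapping.single (0 :: 'a free_monoid) :: 'b \<Rightarrow> _"
  interpret F: ring ?F by (rule ring_free_algebra)
  interpret J: ideal ?J ?F by (rule ideal_nil_coxeter_ideal)
  interpret h: ring_hom_ring ?F ?N "\<lambda>p. ?J +>\<^bsub>?F\<^esub> p"
    unfolding nil_coxeter_algebra_def by (rule J.rcos_ring_hom_ring)
  have s_carr: "?s c \<in> carrier ?F" for c
    by (simp add: zero_free_monoid_def)
  have s_one: "?s 1 = 1" by simp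
  have minus: "\<ominus>\<^bsub>?F\<^esub> ?s c = ?s (- c)" for c
    by (rule F.minus_equality) (use s_carr in \<open>simp_all flip: single_add\<close>)
  have "subcring (range ?s) ?F"
  proof (rule F.subcringI)
    show "subring (range ?s) ?F"
    proof (rule F.subringI)
      show "range ?s \<subseteq> carrier ?F" using s_carr by blast
      show "\<one>\<^bsub>?F\<^esub> \<in> range ?s" using s_one by (metis free_algebra_simps(4) rangeI)
    qed (auto simp: minus mult_single simp flip: single_add)
  qed (auto simp: mult_single mult.commute)
  then have "subfield (range ?s) ?F"
  proof (rule F.subfieldI)
    have "\<exists>b. ?s b * ?s a = 1 \<and> ?s a * ?s b = 1" if "a \<noteq> 0" for a
      using that by (intro exI[of _ "inverse a"]) (simp add: mult_single)
    moreover have "?s a \<noteq> 0 \<longleftrightarrow> a \<noteq> 0" for a by (simp add: poly_mapping_eq_iff fun_eq_iff lookup_single when_def)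
    ultimately show "Units (?F\<lparr>carrier := range ?s\<rparr>) = range ?s - {\<zero>\<^bsub>?F\<^esub>}"
      by (fastforce simp: Units_def)
  qed
  moreover have "\<one>\<^bsub>?N\<^esub> \<noteq> \<zero>\<^bsub>?N\<^esub>"
  proof
    assume "\<one>\<^bsub>?N\<^esub> = \<zero>\<^bsub>?N\<^esub>"
    then have "\<one>\<^bsub>?F\<^esub> \<in> ?J"
      using J.a_rcos_self[OF F.one_closed] by (simp add: nil_coxeter_algebra_def FactRing_def)
    then show False using one_notin_nil_coxeter_ideal[OF assms, of k] by simp
  qed
  ultimately have "subfield ((\<lambda>p. ?J +>\<^bsub>?F\<^esub> p) ` range ?s) ?N"
    by (rule h.img_is_subfield)
  then show ?thesis by (simp add: nil_coxeter_scalars_def image_image)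
qed

end

theory Submission
  imports Defs Complex_Main
begin

text \<open>Every defining relation identifies two words or kills one, so the braid classes of words that
  are not braid equivalent to a word containing some \<open>i\<close> repeated \<open>d i\<close> times form a basis: for such
  a word, the sum of the coefficients over its braid class is a linear functional that kills the ideal.
  Hence finite dimension means that there are only finitely many nonvanishing words.

  If all exponents are 2, the nonvanishing words are the reduced words of \<open>W\<close>, by the theorems of
  Matsumoto and Tits.

  If some vertex \<open>v\<close> has exponent at least 3, follow a path \<open>P\<close> from \<open>v\<close> along edges labelled 3
  through vertices of exponent 2 as long as the next vertex is unique. If the path exhausts \<open>I\<close>,
  then \<open>W\<close> is of type A and only the exponent at one end exceeds 2. Otherwise the path is stopped by an
  edge to \<open>q\<close> with label at least 4, a neighbour \<open>q\<close> of exponent at least 3, or two neighbours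
  \<open>x\<close>, \<open>y\<close>; for \<open>X = q\<close>, \<open>q q\<close> or \<open>x y\<close> respectively, no power of \<open>P X (rev P)\<close> vanishes.

  Conversely, in type A with exponents \<open>2, \<dots>, 2, D\<close>, every nonvanishing word is braid equivalent to
  some \<open>w'\<close> in the letters below \<open>n\<close> or to \<open>w' n \<dots> n (n - 1) \<dots> p\<close> with fewer than \<open>D\<close> letters
  \<open>n\<close>, which bounds the lengths by induction on \<open>n\<close>.\<close>

section \<open>Words up to braid moves\<close>

text \<open>Plain words suffice: the algebra has no inverses, and the generators of \<open>W\<close>
  are involutions. The congruence is used with the braid relations alone and with squares added.
  Letters are unrestricted; membership in \<open>lists I\<close> is tracked separately.\<close>

inductive word_cong :: "('i list \<times> 'i list) set \<Rightarrow> 'i list \<Rightarrow> 'i list \<Rightarrow> bool"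
  for R where
  refl: "word_cong R w w"
| sym: "word_cong R u v \<Longrightarrow> word_cong R v u"
| trans: "word_cong R u v \<Longrightarrow> word_cong R v w \<Longrightarrow> word_cong R u w"
| append: "word_cong R u u' \<Longrightarrow> word_cong R v v' \<Longrightarrow> word_cong R (u @ v) (u' @ v')"
| relation: "(u, v) \<in> R \<Longrightarrow> word_cong R u v"

lemma word_cong_mono:
  assumes "word_cong R u v" and "R \<subseteq> S"
  shows "word_cong S u v"
  using assms by induction (auto intro: word_cong.intros)

lemma word_cong_context:
  assumes "word_cong R u v"
  shows "word_cong R (x @ u @ y) (x @ v @ y)"
  by (intro word_cong.append word_cong.refl assms)

lemma word_cong_Cons:
  assumes "word_cong R u v"
  shows "word_cong R (i # u) (i # v)"
  using word_cong_context[OF assms, of "[i]" "[]"] by simp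

definition braid_relations :: "'i set \<Rightarrow> ('i \<Rightarrow> 'i \<Rightarrow> enat) \<Rightarrow> ('i list \<times> 'i list) set" where
  "braid_relations I m =
     {(alternating n i j, alternating n j i) | i j n. i \<in> I \<and> j \<in> I \<and> i \<noteq> j \<and> m i j = enat n}"

lemma braid_relationsI:
  "i \<in> I \<Longrightarrow> j \<in> I \<Longrightarrow> i \<noteq> j \<Longrightarrow> m i j = enat n \<Longrightarrow>
    (alternating n i j, alternating n j i) \<in> braid_relations I m"
  unfolding braid_relations_def by blast

lemma braid_relationsE:
  assumes "(u, v) \<in> braid_relations I m"
  obtains i j n where "i \<in> I" "j \<in> I" "i \<noteq> j" "m i j = enat n"
    "u = alternating n i j" "v = alternating n j i"
  using assms unfolding braid_relations_def by blast

abbreviation braid_cong :: "'i set \<Rightarrow> ('i \<Rightarrow> 'i \<Rightarrow> enat) \<Rightarrow> 'i list \<Rightarrow> 'i list \<Rightarrow> bool" where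
  "braid_cong I m \<equiv> word_cong (braid_relations I m)"

text \<open>The combinatorial counterpart of being zero in the algebra: for a Coxeter matrix and a
  word over \<open>I\<close>, the monomial lies in the ideal exactly when the word is vanishing, by
  \<open>vanishing_imp_nil_coxeter_ideal\<close> and \<open>relation_span_class_sum\<close>.\<close>

definition vanishing ::
    "'i set \<Rightarrow> ('i \<Rightarrow> 'i \<Rightarrow> enat) \<Rightarrow> ('i \<Rightarrow> nat) \<Rightarrow> 'i list \<Rightarrow> bool" where
  "vanishing I m d w \<longleftrightarrow> (\<exists>u i v. i \<in> I \<and> braid_cong I m w (u @ replicate (d i) i @ v))"

lemma vanishingI:
  "i \<in> I \<Longrightarrow> braid_cong I m w (u @ replicate (d i) i @ v) \<Longrightarrow> vanishing I m d w"
  unfolding vanishing_def by blast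

definition nonvanishing_words ::
    "'i set \<Rightarrow> ('i \<Rightarrow> 'i \<Rightarrow> enat) \<Rightarrow> ('i \<Rightarrow> nat) \<Rightarrow> 'i list set" where
  "nonvanishing_words I m d = {w \<in> lists I. \<not> vanishing I m d w}"

section \<open>Invariants of braid moves\<close>

lemma length_alternating [simp]: "length (alternating n i j) = n"
  by (induction n arbitrary: i j) auto

lemma map_alternating: "map f (alternating n x y) = alternating n (f x) (f y)"
  by (induction n arbitrary: x y) auto

lemma braid_cong_length:
  assumes "braid_cong I m u v"
  shows "length u = length v"
  using assms by induction (auto simp: braid_relations_def)

lemma coxeter_matrix_ge_2:
  assumes "coxeter_matrix I m" "i \<in> I" "j \<in> I" "m i j = enat n"
  shows "2 \<le> n"
proof -
  have "2 \<le> m i j" using assms unfolding coxeter_matrix_def by (metis order_refl)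
  then show ?thesis using assms(4) by (metis numeral_eq_enat enat_ord_simps(1))
qed

lemma set_alternating_ge_2:
  assumes "2 \<le> n"
  shows "set (alternating n i j) = {i, j}"
proof -
  obtain k where n: "n = Suc (Suc k)" using assms by (metis add_2_eq_Suc le_Suc_ex)
  have "{i, j} \<subseteq> set (alternating n i j)" by (simp add: n)
  then show ?thesis using set_alternating[of n i j] by blast
qed

text \<open>Labels are at least 2, so both sides of a braid relation use both letters. Together with
  \<open>braid_cong_length\<close> this makes every braid class finite.\<close>

lemma braid_cong_set:
  assumes "braid_cong I m u v" and "coxeter_matrix I m"
  shows "set u = set v"
  using assms(1)
proof induction
  case (relation u v)
  then show ?case
    using coxeter_matrix_ge_2[OF assms(2)]
    by (fastforce simp: braid_relations_def set_alternating_ge_2)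
qed auto

lemma vanishing_braid_cong:
  assumes "braid_cong I m u v"
  shows "vanishing I m d u \<longleftrightarrow> vanishing I m d v"
  unfolding vanishing_def using assms by (meson word_cong.sym word_cong.trans)

lemma vanishing_append:
  assumes "vanishing I m d w"
  shows "vanishing I m d (x @ w @ y)"
proof -
  obtain u i v where "i \<in> I" "braid_cong I m w (u @ replicate (d i) i @ v)"
    using assms by (auto simp: vanishing_def)
  then have "i \<in> I \<and> braid_cong I m (x @ w @ y) ((x @ u) @ replicate (d i) i @ (v @ y))"
    using word_cong_context[of _ w "u @ replicate (d i) i @ v" x y] by simp
  then show ?thesis unfolding vanishing_def by blast
qed

lemma finite_nonvanishing_words_iff:
  assumes "finite I"
  shows "finite (nonvanishing_words I m d) \<longleftrightarrow> (\<exists>L. \<forall>w \<in> nonvanishing_words I m d. length w \<le> L)"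
proof
  assume "finite (nonvanishing_words I m d)"
  then have "finite (length ` nonvanishing_words I m d)" by simp
  then show "\<exists>L. \<forall>w \<in> nonvanishing_words I m d. length w \<le> L"
    by (meson Max_ge imageI)
next
  assume "\<exists>L. \<forall>w \<in> nonvanishing_words I m d. length w \<le> L"
  then obtain L where "\<forall>w \<in> nonvanishing_words I m d. length w \<le> L" ..
  then have "nonvanishing_words I m d \<subseteq> {w. set w \<subseteq> I \<and> length w \<le> L}"
    by (auto simp: nonvanishing_words_def)
  then show "finite (nonvanishing_words I m d)"
    using finite_lists_length_le[OF assms] finite_subset by blast
qed

section \<open>Finite dimension and nonvanishing words\<close>

lemma word_monomial_mult:
  "(word_monomial u :: 'i free_monoid \<Rightarrow>\<^sub>0 'k::field) * word_monomial v = word_monomial (u @ v)"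
  by (simp add: word_monomial_def mult_single plus_free_monoid_def)

lemma poly_mapping_sum_single:
  "p = (\<Sum>k\<in>Poly_Mapping.keys p. Poly_Mapping.single k (Poly_Mapping.lookup p k))"
  by (rule poly_mapping_eqI) (simp add: lookup_sum lookup_single when_def in_keys_iff)

text \<open>Building an element from one scalar multiple of a relation in context at a time lets a
  linear functional be checked term by term. The set contains the ideal, by
  \<open>nil_coxeter_ideal_subset_relation_span\<close>.\<close>

inductive_set relation_span ::
    "'i set \<Rightarrow> ('i \<Rightarrow> 'i \<Rightarrow> enat) \<Rightarrow> ('i \<Rightarrow> nat) \<Rightarrow> ('i free_monoid \<Rightarrow>\<^sub>0 'k::field) set"
  for I m d where
  zero: "0 \<in> relation_span I m d"
| braid: "p \<in> relation_span I m d \<Longrightarrow> u \<in> lists I \<Longrightarrow> v \<in> lists I \<Longrightarrow>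
     (a, b) \<in> braid_relations I m \<Longrightarrow>
     p + (Poly_Mapping.single (Word (u @ a @ v)) c - Poly_Mapping.single (Word (u @ b @ v)) c)
       \<in> relation_span I m d"
| nil: "p \<in> relation_span I m d \<Longrightarrow> u \<in> lists I \<Longrightarrow> v \<in> lists I \<Longrightarrow> i \<in> I \<Longrightarrow>
     p + Poly_Mapping.single (Word (u @ replicate (d i) i @ v)) c \<in> relation_span I m d"

lemma relation_span_add:
  assumes "q \<in> relation_span I m d" "p \<in> relation_span I m d"
  shows "p + q \<in> relation_span I m d"
  using assms
proof (induction q)
  case (braid q u v a b c)
  show ?case using relation_span.braid[OF braid.IH[OF braid.prems] braid.hyps(2-4), of c]
    by (simp add: add.assoc)
next
  case (nil q u v i c)
  show ?case using relation_span.nil[OF nil.IH[OF nil.prems] nil.hyps(2-4), of c]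
    by (simp add: add.assoc)
qed simp

lemma relation_span_mult_single:
  assumes "p \<in> relation_span I m d" "x \<in> lists I"
  shows "Poly_Mapping.single (Word x) e * p \<in> relation_span I m d"
    and "p * Poly_Mapping.single (Word x) e \<in> relation_span I m d"
proof -
  show "Poly_Mapping.single (Word x) e * p \<in> relation_span I m d"
    using assms(1)
  proof induction
    case (braid p u v a b c)
    then show ?case
      using relation_span.braid[OF braid.IH, of "x @ u" v a b "e * c"] assms(2)
      by (simp add: distrib_left right_diff_distrib mult_single plus_free_monoid_def)
  next
    case (nil p u v i c)
    then show ?case
      using relation_span.nil[OF nil.IH, of "x @ u" v i "e * c"] assms(2)
      by (simp add: distrib_left mult_single plus_free_monoid_def)
  qed (simp add: relation_span.zero)
  show "p * Poly_Mapping.single (Word x) e \<in> relation_span I m d"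
    using assms(1)
  proof induction
    case (braid p u v a b c)
    then show ?case
      using relation_span.braid[OF braid.IH, of u "v @ x" a b "c * e"] assms(2)
      by (simp add: distrib_right left_diff_distrib mult_single plus_free_monoid_def)
  next
    case (nil p u v i c)
    then show ?case
      using relation_span.nil[OF nil.IH, of u "v @ x" i "c * e"] assms(2)
      by (simp add: distrib_right mult_single plus_free_monoid_def)
  qed (simp add: relation_span.zero)
qed

lemma relation_span_sum:
  assumes "finite S" "\<And>k. k \<in> S \<Longrightarrow> f k \<in> relation_span I m d"
  shows "sum f S \<in> relation_span I m d"
  using assms by (induction S rule: finite_induct) (auto intro: relation_span.zero relation_span_add)

lemma relation_span_mult:
  assumes "p \<in> relation_span I m d" "q \<in> carrier (free_algebra k I)"
  shows "q * p \<in> relation_span I m d" and "p * q \<in> relation_span I m d"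
proof -
  have w: "letters w \<in> lists I" if "w \<in> Poly_Mapping.keys q" for w
    using that assms(2) by auto
  have "(\<Sum>w\<in>Poly_Mapping.keys q. Poly_Mapping.single w (Poly_Mapping.lookup q w)) * p
      \<in> relation_span I m d"
    unfolding sum_distrib_right
    using relation_span_mult_single(1)[OF assms(1) w] by (intro relation_span_sum) auto
  then show "q * p \<in> relation_span I m d" by (simp flip: poly_mapping_sum_single)
  have "p * (\<Sum>w\<in>Poly_Mapping.keys q. Poly_Mapping.single w (Poly_Mapping.lookup q w))
      \<in> relation_span I m d"
    unfolding sum_distrib_left
    using relation_span_mult_single(2)[OF assms(1) w] by (intro relation_span_sum) auto
  then show "p * q \<in> relation_span I m d" by (simp flip: poly_mapping_sum_single)
qed

lemma braid_relations_lists: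
  assumes "(a, b) \<in> braid_relations I m"
  shows "a \<in> lists I" "b \<in> lists I"
  using assms set_alternating by (fastforce simp: braid_relations_def)+

lemma single_in_carrier:
  "w \<in> lists I \<Longrightarrow> Poly_Mapping.single (Word w) c \<in> carrier (free_algebra k I)"
  by auto

lemma word_monomial_in_carrier:
  "w \<in> lists I \<Longrightarrow> word_monomial w \<in> carrier (free_algebra k I)"
  by (auto simp: word_monomial_def)

lemma free_algebra_uminus:
  assumes "p \<in> carrier (free_algebra k I)"
  shows "\<ominus>\<^bsub>free_algebra k I\<^esub> p = - p"
proof -
  interpret F: ring "free_algebra k I" by (rule ring_free_algebra)
  show ?thesis by (rule F.minus_equality) (use assms in simp_all)
qed

lemma relation_span_carrier:
  fixes I :: "'i set"
  shows "relation_span I m d \<subseteq> carrier (free_algebra TYPE('k::field) I)"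
proof
  interpret F: ring "free_algebra TYPE('k) I" by (rule ring_free_algebra)
  have minus: "p - q \<in> carrier (free_algebra TYPE('k) I)"
    if "p \<in> carrier (free_algebra TYPE('k) I)" "q \<in> carrier (free_algebra TYPE('k) I)" for p q
    using F.minus_closed[OF that] free_algebra_uminus[OF that(2)] that by (simp add: a_minus_def)
  fix p :: "'i free_monoid \<Rightarrow>\<^sub>0 'k" assume "p \<in> relation_span I m d"
  then show "p \<in> carrier (free_algebra TYPE('k) I)"
  proof induction
    case zero
    show ?case using F.zero_closed by simp
  next
    case (braid p u v a b c)
    have "u @ a @ v \<in> lists I" "u @ b @ v \<in> lists I"
      using braid_relations_lists[OF braid.hyps(4)] braid.hyps(2,3) by auto
    then show ?case
      using F.a_closed[OF braid.IH minus[OF single_in_carrier single_in_carrier]]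
      by (simp del: free_algebra_simps(1))
  next
    case (nil p u v i c)
    then have "u @ replicate (d i) i @ v \<in> lists I" by auto
    then show ?case using F.a_closed[OF nil.IH single_in_carrier]
      by (simp del: free_algebra_simps(1))
  qed
qed

text \<open>The span is itself a two-sided ideal containing the generators, so minimality of the
  generated ideal applies.\<close>

lemma nil_coxeter_ideal_subset_relation_span:
  fixes I :: "'i set"
  shows "nil_coxeter_ideal TYPE('k::field) I (replace_diagonal m d) \<subseteq> relation_span I m d"
proof -
  let ?F = "free_algebra TYPE('k) I"
  let ?S = "relation_span I m d :: ('i free_monoid \<Rightarrow>\<^sub>0 'k) set"
  interpret F: ring ?F by (rule ring_free_algebra)
  have "ideal ?S ?F"
  proof (rule idealI)
    show "subgroup ?S (add_monoid ?F)"
    proof (rule group.subgroupI[OF F.a_group])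
      show "?S \<subseteq> carrier (add_monoid ?F)" using relation_span_carrier by simp
      show "?S \<noteq> {}" using relation_span.zero by blast
    next
      fix p assume p: "p \<in> ?S"
      \<comment> \<open>Negation is multiplication by the constant -1, a multiple of the empty
        word.\<close>
      have "Poly_Mapping.single (Word []) (-1) * p \<in> ?S"
        by (rule relation_span_mult_single(1)[OF p]) simp
      moreover have "Poly_Mapping.single (Word []) (-1) = (- 1 :: 'i free_monoid \<Rightarrow>\<^sub>0 'k)"
        by (simp add: single_uminus flip: zero_free_monoid_def)
      ultimately have "- p \<in> ?S" by simp
      moreover have "\<ominus>\<^bsub>?F\<^esub> p = - p"
        using relation_span_carrier p by (intro free_algebra_uminus) blast
      ultimately show "inv\<^bsub>add_monoid ?F\<^esub> p \<in> ?S" by (simp add: a_inv_def)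
    next
      fix p q assume "p \<in> ?S" "q \<in> ?S"
      then show "p \<otimes>\<^bsub>add_monoid ?F\<^esub> q \<in> ?S" by (simp add: relation_span_add)
    qed
  next
    fix p q assume "p \<in> ?S" "q \<in> carrier ?F"
    then show "q \<otimes>\<^bsub>?F\<^esub> p \<in> ?S" "p \<otimes>\<^bsub>?F\<^esub> q \<in> ?S"
      using relation_span_mult[of p I m d q] by (auto simp del: free_algebra_simps(1))
  qed (rule F.ring_axioms)
  moreover have "nil_coxeter_relations I (replace_diagonal m d) \<subseteq> ?S"
  proof
    fix r :: "'i free_monoid \<Rightarrow>\<^sub>0 'k"
    assume "r \<in> nil_coxeter_relations I (replace_diagonal m d)"
    then show "r \<in> ?S"
      unfolding nil_coxeter_relations_def replace_diagonal_def
    proof (elim UnE)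
      assume "r \<in> {word_monomial (alternating n i j) - word_monomial (alternating n j i) | i j n.
        i \<in> I \<and> j \<in> I \<and> i \<noteq> j \<and> (if i = j then enat (d i) else m i j) = enat n}"
      then obtain i j n where ij: "i \<in> I" "j \<in> I" "i \<noteq> j" "m i j = enat n"
        and r: "r = word_monomial (alternating n i j) - word_monomial (alternating n j i)"
        by (auto split: if_splits)
      have "(alternating n i j, alternating n j i) \<in> braid_relations I m"
        unfolding braid_relations_def using ij by blast
      from relation_span.braid[OF relation_span.zero _ _ this, where u = "[]" and v = "[]" and d = d and c = 1]
      show ?thesis by (simp add: r word_monomial_def)
    next
      assume "r \<in> {word_monomial (replicate n i) | i n.
        i \<in> I \<and> (if i = i then enat (d i) else m i i) = enat n}"
      then obtain i where i: "i \<in> I" and r: "r = word_monomial (replicate (d i) i)" by auto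
      from relation_span.nil[OF relation_span.zero _ _ i, where u = "[]" and v = "[]" and m = m and d = d and c = 1]
      show ?thesis by (simp add: r word_monomial_def)
    qed
  qed
  ultimately show ?thesis
    unfolding nil_coxeter_ideal_def by (rule F.genideal_minimal)
qed

text \<open>A braid term contributes \<open>c - c\<close> or nothing, its two words being both in
  the class of \<open>w\<close> or both outside. A nil term contributes nothing, since no word in
  the class of a nonvanishing \<open>w\<close> contains a forbidden power.\<close>

lemma relation_span_class_sum:
  assumes "coxeter_matrix I m" "\<not> vanishing I m d w" "p \<in> relation_span I m d"
  shows "(\<Sum>v | braid_cong I m w v. Poly_Mapping.lookup p (Word v)) = 0"
proof -
  let ?C = "{v. braid_cong I m w v}"
  \<comment> \<open>Finiteness of the class lets the sum be evaluated; over an infinite set it would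
    be 0 by default.\<close>
  have "?C \<subseteq> {v. set v \<subseteq> set w \<and> length v \<le> length w}"
    using braid_cong_set[OF _ assms(1)] braid_cong_length by fastforce
  then have fin: "finite ?C" using finite_lists_length_le[of "set w"] finite_subset by blast
  have single: "(\<Sum>v\<in>?C. Poly_Mapping.lookup (Poly_Mapping.single (Word u) c) (Word v))
      = (if braid_cong I m w u then c else 0)" for u and c :: 'b
    using fin by (simp add: lookup_single when_def)
  show ?thesis using assms(3)
  proof induction
    case (braid p u v a b c)
    have "braid_cong I m (u @ a @ v) (u @ b @ v)"
      by (rule word_cong_context[OF word_cong.relation[OF braid.hyps(4)]])
    then have "braid_cong I m w (u @ a @ v) \<longleftrightarrow> braid_cong I m w (u @ b @ v)"
      by (meson word_cong.sym word_cong.trans)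
    then show ?case using braid.IH
      by (simp add: lookup_add lookup_minus sum.distrib sum_subtractf single)
  next
    case (nil p u v i c)
    have "\<not> braid_cong I m w (u @ replicate (d i) i @ v)"
      using assms(2) nil.hyps(4) unfolding vanishing_def by blast
    then show ?case using nil.IH by (simp add: lookup_add sum.distrib single)
  qed simp
qed

text \<open>Each braid move changes the monomial by an element of the ideal, so \<open>w\<close> may
  be replaced by a braid equivalent word with a factor \<open>replicate (d i) i\<close>.\<close>

lemma vanishing_imp_nil_coxeter_ideal:
  fixes I :: "'i set"
  assumes "coxeter_matrix I m" "w \<in> lists I" "vanishing I m d w"
  shows "word_monomial w \<in> nil_coxeter_ideal TYPE('k::field) I (replace_diagonal m d)"
proof -
  let ?F = "free_algebra TYPE('k) I"
  let ?J = "nil_coxeter_ideal TYPE('k) I (replace_diagonal m d)"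
  interpret J: ideal ?J ?F by (rule ideal_nil_coxeter_ideal)
  have gen: "r \<in> ?J" if "r \<in> nil_coxeter_relations I (replace_diagonal m d)" for r
    unfolding nil_coxeter_ideal_def
    using J.genideal_self[OF nil_coxeter_relations_carrier] that by blast
  have add: "p + q \<in> ?J" if "p \<in> ?J" "q \<in> ?J" for p q
    using additive_subgroup.a_closed[OF J.is_additive_subgroup that] by simp
  have uminus: "- p \<in> ?J" if "p \<in> ?J" for p
    using additive_subgroup.a_inv_closed[OF J.is_additive_subgroup that] free_algebra_uminus[OF J.Icarr[OF that]] by simp
  have mono: "word_monomial u * p \<in> ?J" "p * word_monomial u \<in> ?J"
    if "p \<in> ?J" "u \<in> lists I" for p u
    using J.I_l_closed[OF that(1) word_monomial_in_carrier[OF that(2)]]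
      J.I_r_closed[OF that(1) word_monomial_in_carrier[OF that(2)]] by simp_all
  have cong: "word_monomial u - word_monomial v \<in> ?J"
    if "braid_cong I m u v" "u \<in> lists I" for u v
    using that
  proof induction
    case (refl w)
    then show ?case using additive_subgroup.zero_closed[OF J.is_additive_subgroup] by simp
  next
    case (sym u v)
    then have "u \<in> lists I" using braid_cong_set[OF sym.hyps assms(1)] by auto
    then show ?case using uminus[OF sym.IH] by simp
  next
    case (trans u v w)
    then have "v \<in> lists I" using braid_cong_set[OF trans.hyps(1) assms(1)] by auto
    then show ?case using add[OF trans.IH(1)[OF trans.prems] trans.IH(2)] by simp
  next
    case (append u u' v v')
    then have in_I: "u \<in> lists I" "v \<in> lists I" "u' \<in> lists I"
      using braid_cong_set[OF append.hyps(1) assms(1)] by auto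
    \<comment> \<open>The telescoping identity
      \<open>u v - u' v' = (u - u') v + u' (v - v')\<close>.\<close>
    have "(word_monomial u - word_monomial u') * word_monomial v
        + word_monomial u' * (word_monomial v - word_monomial v') \<in> ?J"
      by (intro add mono append.IH in_I)
    then show ?case by (simp add: left_diff_distrib right_diff_distrib word_monomial_mult)
  next
    case (relation u v)
    then show ?case
      by (intro gen) (auto simp: braid_relations_def nil_coxeter_relations_def replace_diagonal_def)
  qed
  obtain u i v where i: "i \<in> I" and c: "braid_cong I m w (u @ replicate (d i) i @ v)"
    using assms(3) by (auto simp: vanishing_def)
  have uv: "u \<in> lists I" "v \<in> lists I" using braid_cong_set[OF c assms(1)] assms(2) by auto
  have "word_monomial (replicate (d i) i) \<in> ?J"
    using i by (intro gen) (auto simp: nil_coxeter_relations_def replace_diagonal_def)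
  then have "word_monomial u * (word_monomial (replicate (d i) i) * word_monomial v) \<in> ?J"
    by (intro mono uv)
  then have "word_monomial (u @ replicate (d i) i @ v) \<in> ?J" by (simp add: word_monomial_mult)
  from add[OF cong[OF c assms(2)] this] show ?thesis by simp
qed

text \<open>Finite dimension gives every class a representative supported on words of length at most
  some fixed \<open>L\<close>. A longer nonvanishing word would differ from such a representative by
  an element of the ideal, yet the sum over its braid class would be 1.\<close>

lemma finite_dimensional_imp_nonvanishing_bounded:
  fixes I :: "'i set"
  assumes "coxeter_matrix I m"
    and "nil_coxeter_finite_dimensional TYPE('k::field) I (replace_diagonal m d)"
  shows "\<exists>L. \<forall>w\<in>nonvanishing_words I m d. length w \<le> L"
proof -
  let ?F = "free_algebra TYPE('k) I"
  let ?J = "nil_coxeter_ideal TYPE('k) I (replace_diagonal m d)"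
  let ?N = "nil_coxeter_algebra TYPE('k) I (replace_diagonal m d)"
  let ?K = "nil_coxeter_scalars TYPE('k) I (replace_diagonal m d)"
  interpret F: ring ?F by (rule ring_free_algebra)
  interpret J: ideal ?J ?F by (rule ideal_nil_coxeter_ideal)
  interpret N: ring ?N by (rule ring_nil_coxeter_algebra)
  interpret h: ring_hom_ring ?F ?N "\<lambda>p. ?J +>\<^bsub>?F\<^esub> p"
    unfolding nil_coxeter_algebra_def by (rule J.rcos_ring_hom_ring)
  have carr: "\<exists>p\<in>carrier ?F. X = ?J +>\<^bsub>?F\<^esub> p" if "X \<in> carrier ?N" for X
    using that by (auto simp: nil_coxeter_algebra_def FactRing_def A_RCOSETS_def' simp del: free_algebra_simps(1))
  define short where "short L X \<longleftrightarrow> (\<exists>p\<in>carrier ?F. X = ?J +>\<^bsub>?F\<^esub> p \<and>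
    (\<forall>w\<in>Poly_Mapping.keys p. length (letters w) \<le> L))" for L X
  \<comment> \<open>Induction on the dimension: adjoining a vector raises the bound at most to the
    longest word in a chosen representative of that vector.\<close>
  have "\<exists>L. \<forall>X\<in>E. short L X" if "N.dimension n ?K E" for n E
    using that
  proof (induction n ?K E rule: N.dimension.induct)
    case zero_dim
    have "short 0 \<zero>\<^bsub>?N\<^esub>"
      unfolding short_def using h.hom_zero by (intro bexI[of _ 0]) auto
    then show ?case by blast
  next
    case (Suc_dim v E n)
    then obtain L where L: "\<forall>X\<in>E. short L X" by auto
    obtain q where q: "q \<in> carrier ?F" "v = ?J +>\<^bsub>?F\<^esub> q" using carr[OF Suc_dim.hyps(1)] by blast
    \<comment> \<open>Inserting \<open>L\<close> gives \<open>L \<le> L'\<close> and keeps the set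
      nonempty when \<open>q\<close> is 0.\<close>
    define L' where "L' = Max (insert L ((\<lambda>w. length (letters w)) ` Poly_Mapping.keys q))"
    have L': "L \<le> L'" "\<And>w. w \<in> Poly_Mapping.keys q \<Longrightarrow> length (letters w) \<le> L'"
      unfolding L'_def by auto
    have "short L' X" if "X \<in> N.line_extension ?K v E" for X
    proof -
      obtain s e where s: "s \<in> ?K" and e: "e \<in> E" and X: "X = s \<otimes>\<^bsub>?N\<^esub> v \<oplus>\<^bsub>?N\<^esub> e"
        using \<open>X \<in> N.line_extension ?K v E\<close> N.line_extension_mem_iff by auto
      obtain c where c: "s = ?J +>\<^bsub>?F\<^esub> Poly_Mapping.single 0 c"
        using s by (auto simp: nil_coxeter_scalars_def)
      obtain p where p: "p \<in> carrier ?F" "e = ?J +>\<^bsub>?F\<^esub> p"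
        "\<forall>w\<in>Poly_Mapping.keys p. length (letters w) \<le> L"
        using L e unfolding short_def by blast
      have sc: "Poly_Mapping.single 0 c \<in> carrier ?F" by (simp add: zero_free_monoid_def)
      let ?r = "Poly_Mapping.single 0 c * q + p"
      have r: "?r \<in> carrier ?F"
        using F.a_closed[OF F.m_closed[OF sc q(1)] p(1)] by simp
      have X': "X = ?J +>\<^bsub>?F\<^esub> ?r"
        using h.hom_add[OF F.m_closed[OF sc q(1)] p(1)] h.hom_mult[OF sc q(1)]
        by (simp add: X c q p del: free_algebra_simps(1))
      have "Poly_Mapping.keys ?r \<subseteq> Poly_Mapping.keys q \<union> Poly_Mapping.keys p"
      proof -
        have "Poly_Mapping.keys (Poly_Mapping.single 0 c * q) \<subseteq> Poly_Mapping.keys q"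
          using keys_mult[of "Poly_Mapping.single 0 c" q] by (auto split: if_splits)
        then show ?thesis using Poly_Mapping.keys_add[of "Poly_Mapping.single 0 c * q" p] by blast
      qed
      then have "\<forall>w\<in>Poly_Mapping.keys ?r. length (letters w) \<le> L'"
        using L' p(3) by (meson UnE le_trans subsetD)
      then show ?thesis unfolding short_def using r X' by blast
    qed
    then show ?case by (intro exI[of _ L'] ballI)
  qed
  then obtain L where L: "\<And>X. X \<in> carrier ?N \<Longrightarrow> short L X"
    using assms(2) unfolding nil_coxeter_finite_dimensional_def N.finite_dimension_def by blast
  have "length w \<le> L" if w: "w \<in> nonvanishing_words I m d" for w
  proof (rule ccontr)
    assume "\<not> length w \<le> L"
    have w': "w \<in> lists I" "\<not> vanishing I m d w" using w by (auto simp: nonvanishing_words_def)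
    let ?w = "word_monomial w :: 'i free_monoid \<Rightarrow>\<^sub>0 'k"
    have wF: "?w \<in> carrier ?F" by (rule word_monomial_in_carrier[OF w'(1)])
    obtain p where p: "p \<in> carrier ?F" "?J +>\<^bsub>?F\<^esub> ?w = ?J +>\<^bsub>?F\<^esub> p"
      "\<forall>w\<in>Poly_Mapping.keys p. length (letters w) \<le> L"
      using L[OF h.hom_closed[OF wF]] unfolding short_def by blast
    have "?w \<ominus>\<^bsub>?F\<^esub> p \<in> ?J"
      using F.quotient_eq_iff_same_a_r_cos[OF J.ideal_axioms wF p(1)] p(2) by blast
    then have "?w - p \<in> relation_span I m d"
      using nil_coxeter_ideal_subset_relation_span free_algebra_uminus[OF p(1)]
      by (auto simp: a_minus_def simp del: free_algebra_simps(1))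
    then have sum0: "(\<Sum>v | braid_cong I m w v. Poly_Mapping.lookup (?w - p) (Word v)) = 0"
      by (rule relation_span_class_sum[OF assms(1) w'(2)])
    have p0: "Poly_Mapping.lookup p (Word v) = 0" if "braid_cong I m w v" for v
    proof -
      have "Word v \<notin> Poly_Mapping.keys p"
        using p(3) braid_cong_length[OF that] \<open>\<not> length w \<le> L\<close> by fastforce
      then show ?thesis by (simp add: in_keys_iff)
    qed
    have "finite {v. braid_cong I m w v}"
    proof (rule finite_subset)
      show "{v. braid_cong I m w v} \<subseteq> {v. set v \<subseteq> set w \<and> length v \<le> length w}"
        using braid_cong_set[OF _ assms(1)] braid_cong_length by fastforce
    qed (simp add: finite_lists_length_le)
    \<comment> \<open>Only \<open>w\<close> itself contributes: the words of its class are as long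
      as \<open>w\<close>, too long to occur in \<open>p\<close>.\<close>
    then have "(\<Sum>v | braid_cong I m w v. Poly_Mapping.lookup (?w - p) (Word v)) = 1"
      using p0 by (simp add: lookup_minus word_monomial_def lookup_single when_def word_cong.refl)
    then show False using sum0 by simp
  qed
  then show ?thesis by blast
qed

text \<open>The classes of the nonvanishing words span the quotient, because every other monomial
  maps to 0.\<close>

lemma finite_nonvanishing_imp_finite_dimensional:
  fixes I :: "'i set"
  assumes "coxeter_matrix I m" and "\<forall>i\<in>I. 2 \<le> d i"
    and "finite (nonvanishing_words I m d)"
  shows "nil_coxeter_finite_dimensional TYPE('k::field) I (replace_diagonal m d)"
proof -
  let ?F = "free_algebra TYPE('k) I"
  let ?J = "nil_coxeter_ideal TYPE('k) I (replace_diagonal m d)"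
  let ?N = "nil_coxeter_algebra TYPE('k) I (replace_diagonal m d)"
  let ?K = "nil_coxeter_scalars TYPE('k) I (replace_diagonal m d)"
  interpret F: ring ?F by (rule ring_free_algebra)
  interpret J: ideal ?J ?F by (rule ideal_nil_coxeter_ideal)
  interpret N: ring ?N by (rule ring_nil_coxeter_algebra)
  interpret h: ring_hom_ring ?F ?N "\<lambda>p. ?J +>\<^bsub>?F\<^esub> p"
    unfolding nil_coxeter_algebra_def by (rule J.rcos_ring_hom_ring)
  \<comment> \<open>Nonzero entries keep 1 out of the ideal, so the scalars form a subfield and
    spans over it are available.\<close>
  have "replace_diagonal m d i j \<noteq> 0" if "i \<in> I" "j \<in> I" for i j
  proof (cases "i = j")
    case True
    then show ?thesis using assms(2) that by (auto simp: replace_diagonal_def zero_enat_def)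
  next
    case False
    then have "2 \<le> m i j" using assms(1) that by (auto simp: coxeter_matrix_def)
    then show ?thesis using False by (auto simp: replace_diagonal_def)
  qed
  then have "\<forall>i\<in>I. \<forall>j\<in>I. replace_diagonal m d i j \<noteq> 0" by blast
  then have K: "subfield ?K ?N" by (rule subfield_nil_coxeter_scalars)
  obtain ws where ws: "set ws = nonvanishing_words I m d" using finite_list[OF assms(3)] by blast
  define Us where "Us = map (\<lambda>w. ?J +>\<^bsub>?F\<^esub> word_monomial w) ws"
  have Us: "set Us \<subseteq> carrier ?N"
    unfolding Us_def using ws h.hom_closed[OF word_monomial_in_carrier]
    by (auto simp: nonvanishing_words_def)
  have mono: "?J +>\<^bsub>?F\<^esub> word_monomial w \<in> N.Span ?K Us" if "w \<in> lists I" for w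
  proof (cases "vanishing I m d w")
    case True
    then have "?J +>\<^bsub>?F\<^esub> word_monomial w = \<zero>\<^bsub>?N\<^esub>"
      using J.a_rcos_const[OF vanishing_imp_nil_coxeter_ideal[OF assms(1) that True]]
      by (simp add: nil_coxeter_algebra_def FactRing_def)
    then show ?thesis using N.Span_subgroup_props(2)[OF K Us] by simp
  next
    case False
    then have "?J +>\<^bsub>?F\<^esub> word_monomial w \<in> set Us"
      using that ws by (simp add: Us_def nonvanishing_words_def)
    then show ?thesis using N.Span_base_incl[OF K Us] by blast
  qed
  have sum: "?J +>\<^bsub>?F\<^esub> (\<Sum>k\<in>S. Poly_Mapping.single k (c k)) \<in> N.Span ?K Us"
    if "finite S" "\<forall>k\<in>S. letters k \<in> lists I" for S c
    using that
  proof induction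
    case empty
    have "?J +>\<^bsub>?F\<^esub> 0 = \<zero>\<^bsub>?N\<^esub>" using h.hom_zero by simp
    then show ?case using N.Span_subgroup_props(2)[OF K Us] by simp
  next
    case (insert k S)
    have k: "letters k \<in> lists I" using insert.prems by simp
    let ?s = "Poly_Mapping.single (0 :: 'i free_monoid) (c k) :: 'i free_monoid \<Rightarrow>\<^sub>0 'k"
    have s: "?s \<in> carrier ?F" by (simp add: zero_free_monoid_def)
    have sK: "?J +>\<^bsub>?F\<^esub> ?s \<in> ?K" by (simp add: nil_coxeter_scalars_def)
    have single: "Poly_Mapping.single k (c k) = ?s * word_monomial (letters k)"
      by (simp add: word_monomial_def mult_single)
    have sumF: "(\<Sum>k\<in>S. Poly_Mapping.single k (c k)) \<in> carrier ?F"
    proof -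
      have "Poly_Mapping.keys (\<Sum>k\<in>S. Poly_Mapping.single k (c k)) \<subseteq> S"
        using keys_sum[of "\<lambda>k. Poly_Mapping.single k (c k)" S] by (auto split: if_splits)
      then show ?thesis using insert.prems by auto
    qed
    have IH: "?J +>\<^bsub>?F\<^esub> (\<Sum>k\<in>S. Poly_Mapping.single k (c k)) \<in> N.Span ?K Us"
      using insert by simp
    have "?J +>\<^bsub>?F\<^esub> (Poly_Mapping.single k (c k) + (\<Sum>k\<in>S. Poly_Mapping.single k (c k)))
       = (?J +>\<^bsub>?F\<^esub> ?s) \<otimes>\<^bsub>?N\<^esub> (?J +>\<^bsub>?F\<^esub> word_monomial (letters k))
         \<oplus>\<^bsub>?N\<^esub> (?J +>\<^bsub>?F\<^esub> (\<Sum>k\<in>S. Poly_Mapping.single k (c k)))"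
      using h.hom_add[OF F.m_closed[OF s word_monomial_in_carrier[OF k]] sumF]
        h.hom_mult[OF s word_monomial_in_carrier[OF k]] single
      by (simp del: free_algebra_simps(1))
    also have "\<dots> \<in> N.Span ?K Us"
      by (intro N.Span_subgroup_props(3)[OF K Us] IH N.Span_smult_closed[OF K Us] sK mono k)
    finally show ?case using insert.hyps by simp
  qed
  have "carrier ?N \<subseteq> N.Span ?K Us"
  proof
    fix X assume "X \<in> carrier ?N"
    then obtain p where p: "p \<in> carrier ?F" "X = ?J +>\<^bsub>?F\<^esub> p"
      by (auto simp: nil_coxeter_algebra_def FactRing_def A_RCOSETS_def' simp del: free_algebra_simps(1))
    have "\<forall>k\<in>Poly_Mapping.keys p. letters k \<in> lists I" using p(1) by auto
    then have "?J +>\<^bsub>?F\<^esub> (\<Sum>k\<in>Poly_Mapping.keys p.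
        Poly_Mapping.single k (Poly_Mapping.lookup p k)) \<in> N.Span ?K Us"
      by (intro sum) auto
    then show "X \<in> N.Span ?K Us" using p(2) by (simp flip: poly_mapping_sum_single)
  qed
  then have "carrier ?N = N.Span ?K Us" using N.Span_in_carrier[OF _ Us] subfieldE(3)[OF K] by blast
  then show ?thesis
    unfolding nil_coxeter_finite_dimensional_def using N.Span_finite_dimension[OF K Us] by simp
qed

theorem finite_dimensional_iff_finite_nonvanishing:
  assumes "coxeter_matrix I m" and "\<forall>i\<in>I. 2 \<le> d i"
  shows "nil_coxeter_finite_dimensional TYPE('k::field) I (replace_diagonal m d) \<longleftrightarrow>
    finite (nonvanishing_words I m d)"
proof
  assume "nil_coxeter_finite_dimensional TYPE('k) I (replace_diagonal m d)"
  moreover have "finite I" using assms(1) by (simp add: coxeter_matrix_def)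
  ultimately show "finite (nonvanishing_words I m d)"
    using finite_dimensional_imp_nonvanishing_bounded[OF assms(1)]
    by (simp add: finite_nonvanishing_words_iff)
qed (rule finite_nonvanishing_imp_finite_dimensional[OF assms])

section \<open>The word problem in Coxeter groups\<close>

lemma rev_in_lists_iff [simp]: "rev w \<in> lists I \<longleftrightarrow> w \<in> lists I"
  by (simp add: in_lists_conv_set)

lemma alternating_add:
  "alternating (a + b) i j =
     alternating a i j @ (if even a then alternating b i j else alternating b j i)"
  by (induction a arbitrary: i j) auto

lemma rev_alternating:
  "rev (alternating n i j) = (if odd n then alternating n i j else alternating n j i)"
proof (induction n arbitrary: i j)
  case (Suc n)
  have "alternating (Suc n) i j = alternating n i j @ [if even n then i else j]" for i j :: 'a
    using alternating_add[of n 1 i j] by simp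
  from this[of i j] this[of j i] show ?case using Suc[of i j] by (auto split: if_splits)
qed simp

text \<open>With even total length, the word starting with \<open>i\<close> ends with
  \<open>j\<close>, so read from its end it alternates starting with \<open>j\<close>.\<close>

lemma alternating_split_rev:
  assumes "even (a + b)"
  shows "alternating (a + b) i j = alternating a i j @ rev (alternating b j i)"
  using assms by (auto simp: alternating_add rev_alternating)

text \<open>A monoid presentation of \<open>W\<close> by words without formal inverses;
  \<open>element_eq_iff\<close> identifies its classes with the elements of
  \<open>coxeter_group I m\<close>.\<close>

definition coxeter_word_relations :: "'i set \<Rightarrow> ('i \<Rightarrow> 'i \<Rightarrow> enat) \<Rightarrow> ('i list \<times> 'i list) set" where
  "coxeter_word_relations I m = braid_relations I m \<union> {([i, i], []) | i. i \<in> I}"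

locale coxeter =
  fixes I :: "'i set" and m :: "'i \<Rightarrow> 'i \<Rightarrow> enat"
  assumes coxeter_matrix: "coxeter_matrix I m"
begin

abbreviation cong (infix "\<approx>" 50) where
  "u \<approx> v \<equiv> word_cong (coxeter_word_relations I m) u v"

section \<open>Group calculations with words\<close>

lemma cong_sym: "u \<approx> v \<Longrightarrow> v \<approx> u"
  by (rule word_cong.sym)

lemma cong_trans [trans]: "u \<approx> v \<Longrightarrow> v \<approx> w \<Longrightarrow> u \<approx> w"
  by (rule word_cong.trans)

lemma braid_imp_cong: "braid_cong I m u v \<Longrightarrow> u \<approx> v"
  by (erule word_cong_mono) (simp add: coxeter_word_relations_def)

lemma cong_square: "i \<in> I \<Longrightarrow> [i, i] \<approx> []"
  by (rule word_cong.relation) (simp add: coxeter_word_relations_def)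

lemma cong_delete_square:
  assumes "i \<in> I"
  shows "u @ i # i # v \<approx> u @ v"
  using word_cong_context[OF cong_square[OF assms], of u v] by simp

lemma cong_lists:
  assumes "u \<approx> v"
  shows "u \<in> lists I \<longleftrightarrow> v \<in> lists I"
  using assms
proof induction
  case (relation u v)
  then show ?case
    using set_alternating by (fastforce simp: coxeter_word_relations_def braid_relations_def)
qed auto

text \<open>This is the sign character of \<open>W\<close>.\<close>

lemma cong_parity:
  assumes "u \<approx> v"
  shows "even (length u) \<longleftrightarrow> even (length v)"
  using assms by induction (auto simp: coxeter_word_relations_def braid_relations_def)

lemma cong_rev:
  assumes "u \<approx> v"
  shows "rev u \<approx> rev v"
  using assms
proof induction
  case (relation u v)
  then consider i where "i \<in> I" "u = [i, i]" "v = []" | "(u, v) \<in> braid_relations I m"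
    by (auto simp: coxeter_word_relations_def)
  then show ?case
  proof cases
    case 1
    then show ?thesis by (simp add: cong_square)
  next
    case 2
    then obtain i j n where ij: "i \<in> I" "j \<in> I" "i \<noteq> j" "m i j = enat n"
      "u = alternating n i j" "v = alternating n j i"
      by (auto simp: braid_relations_def)
    have "u \<approx> v" by (rule word_cong.relation) (simp add: coxeter_word_relations_def 2)
    then show ?thesis using ij by (auto simp: rev_alternating intro: cong_sym)
  qed
qed (auto intro: word_cong.intros)

lemma cong_rev_cancel:
  assumes "w \<in> lists I"
  shows "rev w @ w \<approx> []"
  using assms
proof (induction w)
  case (Cons i w)
  have "rev w @ i # i # w \<approx> rev w @ w" using Cons.hyps by (intro cong_delete_square) simp
  also have "rev w @ w \<approx> []" using Cons.IH Cons.hyps by simp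
  finally show ?case by simp
qed (simp add: word_cong.refl)

lemma cong_cancel_rev:
  assumes "w \<in> lists I"
  shows "w @ rev w \<approx> []"
  using cong_rev_cancel[of "rev w"] assms by auto

lemma cong_cancel_left:
  assumes "w \<in> lists I"
  shows "w @ u \<approx> w @ v \<longleftrightarrow> u \<approx> v"
proof
  have *: "rev w @ w @ x \<approx> x" for x
    using word_cong.append[OF cong_rev_cancel[OF assms] word_cong.refl, of x] by simp
  assume "w @ u \<approx> w @ v"
  then have "rev w @ w @ u \<approx> rev w @ w @ v" by (rule word_cong.append[OF word_cong.refl])
  with cong_sym[OF *] have "u \<approx> rev w @ w @ v" by (rule cong_trans)
  from this * show "u \<approx> v" by (rule cong_trans)
qed (intro word_cong.append word_cong.refl)

lemma cong_cancel_right: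
  assumes "w \<in> lists I"
  shows "u @ w \<approx> v @ w \<longleftrightarrow> u \<approx> v"
proof
  have w: "rev w \<in> lists I" using assms by auto
  assume "u @ w \<approx> v @ w"
  then have "rev w @ rev u \<approx> rev w @ rev v" using cong_rev[of "u @ w" "v @ w"] by simp
  then show "u \<approx> v" using cong_cancel_left[OF w] cong_rev[of "rev u" "rev v"] by simp
qed (intro word_cong.append word_cong.refl)

lemma cong_move_right:
  assumes "w \<in> lists I"
  shows "u @ w \<approx> v \<longleftrightarrow> u \<approx> v @ rev w"
proof -
  have "(u @ w) @ rev w \<approx> u"
    using word_cong.append[OF word_cong.refl cong_cancel_rev[OF assms], of u] by simp
  moreover have "(u @ w) @ rev w \<approx> v @ rev w \<longleftrightarrow> u @ w \<approx> v"
    using assms by (intro cong_cancel_right) auto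
  ultimately show ?thesis using cong_sym cong_trans by meson
qed

text \<open>The hypothesis amounts to the triviality of the alternating word of length
  \<open>2 * n\<close>. Cutting that word after \<open>a\<close> letters and moving the rest to the
  other side gives the claim.\<close>

lemma cong_alternating_reflection:
  assumes "alternating n i j \<approx> alternating n j i" "i \<in> I" "j \<in> I" "a + b = 2 * n"
  shows "alternating a i j \<approx> alternating b j i"
proof -
  have I: "alternating b j i \<in> lists I" if "i \<in> I" "j \<in> I" for b i j
    using set_alternating[of b j i] that by auto
  have "alternating a i j @ rev (alternating b j i) = alternating (a + b) i j"
    using alternating_split_rev[of a b i j] assms(4) by simp
  also have "\<dots> = alternating (n + n) i j" using assms(4) by (simp add: mult_2)
  also have "\<dots> = alternating n i j @ rev (alternating n j i)"
    by (rule alternating_split_rev) simp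
  also have "\<dots> \<approx> alternating n j i @ rev (alternating n j i)"
    by (intro word_cong.append assms(1) word_cong.refl)
  also have "\<dots> \<approx> []" by (intro cong_cancel_rev I assms)
  finally show ?thesis
    using cong_move_right[of "rev (alternating b j i)" "alternating a i j" "[]"] I[OF assms(2,3)]
    by simp
qed

subsection \<open>The reflection cocycle and the exchange condition\<close>

text \<open>For \<open>w = s\<^sub>1 \<dots> s\<^sub>n\<close>, the parity of the number of \<open>k\<close> such that \<open>t\<close> represents
  the reflection \<open>s\<^sub>1 \<dots> s\<^sub>k \<dots> s\<^sub>1\<close>.\<close>

primrec inversion_parity :: "'i list \<Rightarrow> 'i list \<Rightarrow> bool" where
  "inversion_parity [] t = False"
| "inversion_parity (i # w) t = ((t \<approx> [i]) \<noteq> inversion_parity w (i # t @ [i]))"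

lemma inversion_parity_cong_right:
  assumes "t \<approx> t'"
  shows "inversion_parity w t = inversion_parity w t'"
  using assms
proof (induction w arbitrary: t t')
  case (Cons i w)
  have "t \<approx> [i] \<longleftrightarrow> t' \<approx> [i]" using Cons.prems cong_sym cong_trans by blast
  moreover have "i # t @ [i] \<approx> i # t' @ [i]"
    using word_cong_context[OF Cons.prems, of "[i]" "[i]"] by simp
  ultimately show ?case using Cons.IH by simp
qed simp

text \<open>The cocycle identity: once \<open>u\<close> has been read, \<open>t\<close> has been
  conjugated by the element of \<open>u\<close>.\<close>

lemma inversion_parity_append:
  "inversion_parity (u @ v) t = (inversion_parity u t \<noteq> inversion_parity v (rev u @ t @ u))"
  by (induction u arbitrary: t) auto

lemma cong_conjugate_iff:
  assumes "i \<in> I"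
  shows "i # t @ [i] \<approx> u \<longleftrightarrow> t \<approx> i # u @ [i]"
proof -
  have *: "i # (i # x @ [i]) @ [i] \<approx> x" for x
  proof -
    have "i # i # x @ [i, i] \<approx> [] @ x @ []"
      using word_cong.append[OF cong_square[OF assms]
        word_cong.append[OF word_cong.refl cong_square[OF assms]]] by simp
    then show ?thesis by simp
  qed
  have **: "i # x @ [i] \<approx> i # y @ [i]" if "x \<approx> y" for x y
    using word_cong_context[OF that, of "[i]" "[i]"] by simp
  show ?thesis using * ** cong_sym cong_trans by meson
qed

text \<open>The reflections attached to an alternating word are the alternating words of lengths 1,
  3, ..., \<open>2 * n - 1\<close> with the same first letter.\<close>

lemma inversion_parity_alternating:
  assumes "i \<in> I" "j \<in> I"
  shows "inversion_parity (alternating n i j) t \<longleftrightarrow>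
    odd (\<Sum>k<n. of_bool (t \<approx> alternating (2 * k + 1) i j) :: nat)"
  using assms
proof (induction n arbitrary: i j t)
  case (Suc n)
  have "i # t @ [i] \<approx> alternating (2 * k + 1) j i \<longleftrightarrow> t \<approx> alternating (2 * Suc k + 1) i j" for k
    using cong_conjugate_iff[OF Suc.prems(1)] alternating_add[of "2 * Suc k" 1 i j]
      alternating_add[of "2 * k + 1" 1 j i] by simp
  then show ?case
    using Suc.IH[OF Suc.prems(2,1), of "i # t @ [i]"]
    by (subst sum.lessThan_Suc_shift) simp
qed simp

lemma inversion_parity_braid:
  assumes "i \<in> I" "j \<in> I" "i \<noteq> j" "m i j = enat n"
  shows "inversion_parity (alternating n i j) t = inversion_parity (alternating n j i) t"
proof -
  have "(alternating n i j, alternating n j i) \<in> braid_relations I m"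
    unfolding braid_relations_def using assms by blast
  then have c: "alternating n i j \<approx> alternating n j i"
    by (intro word_cong.relation) (simp add: coxeter_word_relations_def)
  \<comment> \<open>The two odd lengths add up to \<open>2 * n\<close>, so both sides of the braid
    relation have the same reflections, in opposite order.\<close>
  have "alternating (2 * k + 1) i j \<approx> alternating (2 * (n - Suc k) + 1) j i" if "k < n" for k
    using that by (intro cong_alternating_reflection[OF c assms(1,2)]) auto
  then have "t \<approx> alternating (2 * k + 1) i j \<longleftrightarrow> t \<approx> alternating (2 * (n - Suc k) + 1) j i"
    if "k < n" for k
    using that cong_sym cong_trans by blast
  then have "(\<Sum>k<n. of_bool (t \<approx> alternating (2 * k + 1) i j) :: nat)
      = (\<Sum>k<n. of_bool (t \<approx> alternating (2 * (n - Suc k) + 1) j i))"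
    by (intro sum.cong) auto
  also have "\<dots> = (\<Sum>k<n. of_bool (t \<approx> alternating (2 * k + 1) j i))"
    by (rule sum.nat_diff_reindex)
  finally show ?thesis using inversion_parity_alternating assms(1,2) by simp
qed

text \<open>The cocycle identity reduces the claim to single relations. A braid move preserves the
  list of reflections up to order; in a square both letters contribute the reflection
  \<open>[i]\<close>, which cancels modulo 2.\<close>

lemma inversion_parity_cong:
  assumes "u \<approx> v"
  shows "inversion_parity u t = inversion_parity v t"
  using assms
proof (induction arbitrary: t)
  case (append u u' v v')
  have "rev u @ t @ u \<approx> rev u' @ t @ u'"
    by (intro word_cong.append cong_rev append.hyps word_cong.refl)
  then show ?case
    using append.IH inversion_parity_cong_right unfolding inversion_parity_append by blast
next
  case (relation u v)
  then consider i where "i \<in> I" "u = [i, i]" "v = []" | "(u, v) \<in> braid_relations I m"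
    by (auto simp: coxeter_word_relations_def)
  then show ?case
  proof cases
    case 1
    have "[i, i, i] \<approx> [i]" using cong_delete_square[OF 1(1), of "[]" "[i]"] by simp
    then have "t \<approx> [i, i, i] \<longleftrightarrow> t \<approx> [i]" using cong_sym cong_trans by blast
    then show ?thesis using 1 cong_conjugate_iff[OF 1(1), of t "[i]"] by simp
  next
    case 2
    then obtain i j n where ij: "i \<in> I" "j \<in> I" "i \<noteq> j" "m i j = enat n"
      and uv: "u = alternating n i j" "v = alternating n j i" by (elim braid_relationsE)
    show ?thesis unfolding uv by (rule inversion_parity_braid[OF ij])
  qed
qed auto

text \<open>An odd count is nonzero, so \<open>t\<close> is one of the reflections of
  \<open>w\<close>. Multiplying \<open>w\<close> by this reflection on the left deletes the letter
  \<open>k\<close>; this is the exchange condition.\<close>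

lemma inversion_parity_imp_conjugate:
  assumes "inversion_parity w t" "w \<in> lists I"
  shows "\<exists>x k y. w = x @ k # y \<and> t \<approx> x @ [k] @ rev x"
  using assms
proof (induction w arbitrary: t)
  case (Cons i w)
  show ?case
  proof (cases "t \<approx> [i]")
    case True
    then have "i # w = [] @ i # w \<and> t \<approx> [] @ [i] @ rev []" by simp
    then show ?thesis by blast
  next
    case False
    then have "inversion_parity w (i # t @ [i])" using Cons.prems by simp
    then obtain x k y where w: "w = x @ k # y" and t: "i # t @ [i] \<approx> x @ [k] @ rev x"
      using Cons.IH[of "i # t @ [i]"] Cons.prems(2) by (metis in_lists_conv_set list.set_intros(2))
    have "i \<in> I" using Cons.prems by simp
    then have "t \<approx> (i # x) @ [k] @ rev (i # x)"
      using t cong_conjugate_iff[of i t] by simp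
    then show ?thesis using w by (metis append_Cons)
  qed
qed simp

section \<open>Reduced words\<close>

definition reduced :: "'i list \<Rightarrow> bool" where
  "reduced w \<longleftrightarrow> w \<in> lists I \<and> (\<forall>v. v \<approx> w \<longrightarrow> length w \<le> length v)"

lemma reduced_cong:
  assumes "reduced w" "v \<approx> w" "length v \<le> length w"
  shows "reduced v"
  using assms unfolding reduced_def by (meson cong_lists cong_sym cong_trans le_trans)

lemma exists_reduced:
  assumes "w \<in> lists I"
  shows "\<exists>v. reduced v \<and> v \<approx> w"
proof -
  obtain v where v: "v \<approx> w" "\<And>u. u \<approx> w \<Longrightarrow> length v \<le> length u"
    using arg_min_nat_lemma[of "\<lambda>v. v \<approx> w" w length] word_cong.refl by blast
  then have "reduced v" unfolding reduced_def by (meson assms cong_lists cong_trans)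
  then show ?thesis using v by blast
qed

lemma reduced_appendD:
  assumes "reduced (u @ v)"
  shows "reduced u" "reduced v"
proof -
  have *: "u \<in> lists I" "v \<in> lists I" using assms by (auto simp: reduced_def)
  have "length (u @ v) \<le> length (u' @ v)" if "u' \<approx> u" for u'
    using assms word_cong.append[OF that word_cong.refl] unfolding reduced_def by blast
  then show "reduced u" using * unfolding reduced_def by auto
  have "length (u @ v) \<le> length (u @ v')" if "v' \<approx> v" for v'
    using assms word_cong.append[OF word_cong.refl that] unfolding reduced_def by blast
  then show "reduced v" using * unfolding reduced_def by auto
qed

text \<open>The first letter counts \<open>[i]\<close> once. If \<open>[i]\<close> were counted in
  \<open>w\<close> as well, the exchange condition would shorten \<open>i # w\<close> by two
  letters.\<close>

lemma inversion_parity_reduced_Cons: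
  assumes "reduced (i # w)"
  shows "inversion_parity (i # w) [i]"
proof -
  have i: "i \<in> I" and w: "w \<in> lists I" using assms by (auto simp: reduced_def)
  have "\<not> inversion_parity w [i]"
  proof
    assume "inversion_parity w [i]"
    then obtain x k y where xky: "w = x @ k # y" "[i] \<approx> x @ [k] @ rev x"
      using inversion_parity_imp_conjugate[OF _ w] by blast
    have "i # w \<approx> (x @ [k] @ rev x) @ (x @ k # y)"
      using word_cong.append[OF xky(2) word_cong.refl, of w] xky(1) by simp
    also have "\<dots> \<approx> x @ k # k # y"
      using word_cong_context[OF cong_rev_cancel[of x], of "x @ [k]" "k # y"] w xky(1) by simp
    also have "\<dots> \<approx> x @ y" using w xky(1) by (intro cong_delete_square) simp
    finally have "length (i # w) \<le> length (x @ y)"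
      using assms cong_sym unfolding reduced_def by blast
    then show False using xky(1) by simp
  qed
  moreover have "[i, i, i] \<approx> [i]" using cong_delete_square[OF i, of "[]" "[i]"] by simp
  ultimately show ?thesis
    using inversion_parity_cong_right[of "[i, i, i]" "[i]" w] by (simp add: word_cong.refl)
qed

subsection \<open>The orders of products of two generators\<close>

text \<open>The dual of the geometric representation. Any value below \<open>-2\<close> serves for an infinite label;
  \<open>-5/2\<close> makes the eigenvalues rational.\<close>

definition cartan :: "'i \<Rightarrow> 'i \<Rightarrow> real" where
  "cartan i k = (if i = k then 2 else case m i k of enat n \<Rightarrow> - 2 * cos (pi / n) | \<infinity> \<Rightarrow> - 5 / 2)"

text \<open>A linear form is recorded by its values \<open>l k\<close> on the simple roots. The
  reflection sends the root of \<open>k\<close> to itself minus \<open>cartan i k\<close> times the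
  root of \<open>i\<close>, and the form is composed with it.\<close>

definition geom_refl :: "'i \<Rightarrow> ('i \<Rightarrow> real) \<Rightarrow> 'i \<Rightarrow> real" where
  "geom_refl i l = (\<lambda>k. l k - cartan i k * l i)"

text \<open>If \<open>l\<close> vanishes at \<open>i\<close> and \<open>j\<close>, it is fixed by
  both reflections, so only the coordinates \<open>A\<close> and \<open>B\<close> move.\<close>

definition geom_comb :: "('i \<Rightarrow> real) \<Rightarrow> 'i \<Rightarrow> 'i \<Rightarrow> real \<Rightarrow> real \<Rightarrow> 'i \<Rightarrow> real" where
  "geom_comb l i j A B = (\<lambda>k. l k + A * cartan i k + B * cartan j k)"

lemma cartan_sym: "i \<in> I \<Longrightarrow> j \<in> I \<Longrightarrow> cartan i j = cartan j i"
  using coxeter_matrix by (auto simp: cartan_def coxeter_matrix_def)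

lemma geom_comb_swap: "geom_comb l i j A B = geom_comb l j i B A"
  by (auto simp: geom_comb_def)

text \<open>Reflecting in \<open>i\<close> replaces \<open>A\<close> by \<open>c * B - A\<close> and
  keeps \<open>B\<close>. Alternating reflections therefore move a window of two consecutive terms
  along a solution of the recurrence.\<close>

lemma fold_geom_refl_alternating:
  assumes "l i = 0" "l j = 0" "cartan i j = - c" "cartan j i = - c"
    and "\<And>k. x (Suc (Suc k)) = c * x (Suc k) - x k"
  shows "fold geom_refl (alternating n i j) (geom_comb l i j (x k) (x (Suc k))) =
    (if even n then geom_comb l i j (x (k + n)) (x (Suc (k + n)))
     else geom_comb l i j (x (Suc (k + n))) (x (k + n)))"
  using assms(1-4)
proof (induction n arbitrary: i j k)
  case (Suc n)
  have "geom_refl i (geom_comb l i j (x k) (x (Suc k)))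
      = geom_comb l j i (x (Suc k)) (x (Suc (Suc k)))"
    using Suc.prems by (auto simp: geom_refl_def geom_comb_def cartan_def[of i i] assms(5) algebra_simps)
  then show ?case using Suc.IH[of j i "Suc k"] Suc.prems by (auto simp: geom_comb_swap[of l j i])
qed simp

text \<open>The Cartan matrix of the pair has determinant \<open>4 - c^2\<close>, so the values at
  \<open>i\<close> and \<open>j\<close> determine the coordinates.\<close>

lemma geom_comb_eqD:
  assumes "geom_comb l i j A B = geom_comb l i j A' B'" "c\<^sup>2 \<noteq> 4"
    and "cartan i j = - c" "cartan j i = - c"
  shows "A = A'" "B = B'"
proof -
  define a b where "a = A - A'" and "b = B - B'"
  have "geom_comb l i j A B i = geom_comb l i j A' B' i"
    "geom_comb l i j A B j = geom_comb l i j A' B' j" using assms(1) by simp_all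
  then have 1: "2 * a = c * b" and 2: "2 * b = c * a"
    using assms(3,4) by (simp_all add: geom_comb_def cartan_def[of i i] cartan_def[of j j] a_def b_def algebra_simps)
  have "c * (2 * b) = 2 * (2 * a)" using 1 by simp
  then have "(c\<^sup>2 - 4) * a = 0" unfolding 2 by (simp add: power2_eq_square algebra_simps)
  then have "a = 0" using assms(2) by simp
  then show "A = A'" "B = B'" using 2 by (simp_all add: a_def b_def)
qed

lemma exists_geom_comb:
  assumes "c\<^sup>2 \<noteq> 4" "cartan i j = - c" "cartan j i = - c"
  shows "\<exists>l' A B. l' i = 0 \<and> l' j = 0 \<and> l = geom_comb l' i j A B"
proof -
  \<comment> \<open>Cramer's rule for \<open>2 * A - c * B = l i\<close> and
    \<open>2 * B - c * A = l j\<close>.\<close>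
  define A B where "A = (2 * l i + c * l j) / (4 - c\<^sup>2)" and "B = (c * l i + 2 * l j) / (4 - c\<^sup>2)"
  have D: "4 - c\<^sup>2 \<noteq> 0" using assms(1) by simp
  have AB: "A * (4 - c\<^sup>2) = 2 * l i + c * l j" "B * (4 - c\<^sup>2) = c * l i + 2 * l j"
    unfolding A_def B_def using D by simp_all
  have "(4 - c\<^sup>2) * (2 * A - c * B) = 2 * (A * (4 - c\<^sup>2)) - c * (B * (4 - c\<^sup>2))"
    "(4 - c\<^sup>2) * (2 * B - c * A) = 2 * (B * (4 - c\<^sup>2)) - c * (A * (4 - c\<^sup>2))"
    by (simp_all add: algebra_simps)
  then have "(4 - c\<^sup>2) * (2 * A - c * B) = (4 - c\<^sup>2) * l i"
    "(4 - c\<^sup>2) * (2 * B - c * A) = (4 - c\<^sup>2) * l j"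
    unfolding AB by (simp_all add: algebra_simps power2_eq_square)
  then have "2 * A - c * B = l i" "2 * B - c * A = l j" using D by simp_all
  moreover define l' where "l' k = l k - A * cartan i k - B * cartan j k" for k
  ultimately have "l' i = 0" "l' j = 0"
    using assms(2,3) by (simp_all add: l'_def cartan_def[of i i] cartan_def[of j j] algebra_simps)
  moreover have "l = geom_comb l' i j A B" by (simp add: geom_comb_def l'_def)
  ultimately show ?thesis by blast
qed

text \<open>Solves the recurrence for \<open>c = 2 * cos \<theta>\<close>; the phase
  \<open>\<phi>\<close> provides shifted solutions, so that both initial values can be
  prescribed.\<close>

lemma sin_recurrence:
  "sin (real (Suc (Suc k)) * \<theta> + \<phi>) = 2 * cos \<theta> * sin (real (Suc k) * \<theta> + \<phi>) - sin (real k * \<theta> + \<phi>)"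
proof -
  have 1: "real (Suc (Suc k)) * \<theta> + \<phi> = (real (Suc k) * \<theta> + \<phi>) + \<theta>"
    and 2: "real k * \<theta> + \<phi> = (real (Suc k) * \<theta> + \<phi>) - \<theta>" by (simp_all add: algebra_simps)
  show ?thesis unfolding 1 2 sin_add sin_diff by simp
qed

lemma pi_div_bounds:
  assumes "2 \<le> n"
  shows "sin (pi / real n) > 0" "(2 * cos (pi / real n))\<^sup>2 \<noteq> 4"
proof -
  have "pi / real n < pi" using assms by (simp add: field_simps)
  then show s: "sin (pi / real n) > 0" using assms by (intro sin_gt_zero) auto
  have "(2 * cos (pi / real n))\<^sup>2 = 4 - 4 * (sin (pi / real n))\<^sup>2"
    by (simp add: power_mult_distrib cos_squared_eq)
  then show "(2 * cos (pi / real n))\<^sup>2 \<noteq> 4" using s by simp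
qed

lemma fold_geom_refl_braid:
  assumes "i \<in> I" "j \<in> I" "i \<noteq> j" "m i j = enat n"
  shows "fold geom_refl (alternating n i j) = fold geom_refl (alternating n j i)"
proof
  fix l :: "'i \<Rightarrow> real"
  have n: "2 \<le> n" by (rule coxeter_matrix_ge_2[OF coxeter_matrix assms(1,2,4)])
  define \<theta> where "\<theta> = pi / real n"
  define c where "c = 2 * cos \<theta>"
  have s: "sin \<theta> \<noteq> 0" and c4: "c\<^sup>2 \<noteq> 4" using pi_div_bounds[OF n] by (auto simp: \<theta>_def c_def)
  have cij: "cartan i j = - c" using assms by (simp add: cartan_def c_def \<theta>_def)
  then have cji: "cartan j i = - c" using cartan_sym assms by simp
  \<comment> \<open>The alternating product of length \<open>n\<close> negates both coordinates and
    exchanges them for odd \<open>n\<close>. This description is symmetric in \<open>i\<close> and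
    \<open>j\<close>.\<close>
  have key: "fold geom_refl (alternating n i j) (geom_comb l' i j A B) =
      (if even n then geom_comb l' i j (- A) (- B) else geom_comb l' i j (- B) (- A))"
    if "l' i = 0" "l' j = 0" "cartan i j = - c" "cartan j i = - c" for l' i j A B
  proof -
    \<comment> \<open>The solution with \<open>x 0 = A\<close> and \<open>x 1 = B\<close>. As
      \<open>n * \<theta> = pi\<close>, moving \<open>n\<close> places along it changes its
      sign.\<close>
    define x where "x k = (B * sin (real k * \<theta> + 0) - A * sin (real k * \<theta> + - \<theta>)) / sin \<theta>" for k
    have rec: "x (Suc (Suc k)) = c * x (Suc k) - x k" for k
      unfolding x_def sin_recurrence using s by (simp add: c_def field_simps)
    have n\<theta>: "real n * \<theta> = pi" using n by (simp add: \<theta>_def)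
    have x: "x 0 = A" "x (Suc 0) = B" using s by (simp_all add: x_def)
    have xn: "x n = - A" using s by (simp add: x_def n\<theta> sin_diff)
    have "real (Suc n) * \<theta> = pi + \<theta>" using n\<theta> by (simp add: algebra_simps)
    then have xn1: "x (Suc n) = - B" using s by (simp add: x_def)
    show ?thesis
      using fold_geom_refl_alternating[where x = x and l = l' and k = 0 and n = n, OF that rec] by (simp only: x xn xn1 add_0)
  qed
  obtain l' A B where l: "l' i = 0" "l' j = 0" "l = geom_comb l' i j A B"
    using exists_geom_comb[OF c4 cij cji] by blast
  show "fold geom_refl (alternating n i j) l = fold geom_refl (alternating n j i) l"
    using key[OF l(1,2) cij cji, of A B] key[OF l(2,1) cji cij, of B A]
    by (simp add: l(3) geom_comb_swap[of l' j i])
qed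

lemma fold_geom_refl_cong:
  assumes "u \<approx> v"
  shows "fold geom_refl u = fold geom_refl v"
  using assms
proof induction
  case (relation u v)
  then consider i where "i \<in> I" "u = [i, i]" "v = []" | "(u, v) \<in> braid_relations I m"
    by (auto simp: coxeter_word_relations_def)
  then show ?case
  proof cases
    case 1
    have "cartan i i = 2" by (simp add: cartan_def)
    then show ?thesis using 1 by (auto simp: geom_refl_def fun_eq_iff algebra_simps)
  next
    case 2
    then obtain i j n where ij: "i \<in> I" "j \<in> I" "i \<noteq> j" "m i j = enat n"
      and uv: "u = alternating n i j" "v = alternating n j i" by (elim braid_relationsE)
    show ?thesis unfolding uv by (rule fold_geom_refl_braid[OF ij])
  qed
qed auto

text \<open>The product of the two generators has order exactly \<open>m i j\<close>. Otherwise
  every solution of the recurrence would repeat its two initial values after \<open>2 * p\<close>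
  steps, which the solutions chosen below do not.\<close>

lemma alternating_not_cong:
  assumes "i \<in> I" "j \<in> I" "i \<noteq> j" "0 < p" "enat p < m i j"
  shows "\<not> alternating p i j \<approx> alternating p j i"
proof
  assume "alternating p i j \<approx> alternating p j i"
  then have "alternating (2 * p) i j \<approx> alternating 0 j i"
    by (rule cong_alternating_reflection) (use assms in auto)
  then have id: "fold geom_refl (alternating (2 * p) i j) l = l" for l
    using fold_geom_refl_cong by fastforce
  have key: "x (2 * p) = x 0 \<and> x (Suc (2 * p)) = x (Suc 0)"
    if "c\<^sup>2 \<noteq> 4" "cartan i j = - c" "\<And>k. x (Suc (Suc k)) = c * x (Suc k) - x k" for c x
  proof -
    have cji: "cartan j i = - c" using that(2) cartan_sym assms by simp
    have "geom_comb (\<lambda>_. 0) i j (x (2 * p)) (x (Suc (2 * p))) = geom_comb (\<lambda>_. 0) i j (x 0) (x (Suc 0))"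
      using fold_geom_refl_alternating[where l = "\<lambda>_. 0" and x = x and n = "2 * p" and k = 0,
        OF HOL.refl HOL.refl that(2) cji that(3)] id
      by simp
    from geom_comb_eqD[OF this that(1,2) cji] show ?thesis by simp
  qed
  show False
  proof (cases "m i j")
    case (enat n)
    have n: "2 \<le> n" by (rule coxeter_matrix_ge_2[OF coxeter_matrix assms(1,2) enat])
    define \<theta> where "\<theta> = pi / real n"
    have s: "sin \<theta> \<noteq> 0" and c4: "(2 * cos \<theta>)\<^sup>2 \<noteq> 4" using pi_div_bounds[OF n] by (auto simp: \<theta>_def)
    have "cartan i j = - (2 * cos \<theta>)" using assms(3) enat by (simp add: cartan_def \<theta>_def)
    \<comment> \<open>The two equations say that rotation by \<open>2 * (p * \<theta>)\<close> is
      trivial, whereas \<open>p * \<theta>\<close> lies strictly between 0 and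
      \<open>pi\<close>.\<close>
    from key[OF c4 this, of "\<lambda>k. sin (real k * \<theta> + 0)"]
    have *: "sin (2 * (p * \<theta>)) = 0" "sin (2 * (p * \<theta>) + \<theta>) = sin \<theta>"
      by (simp_all only: sin_recurrence) (simp_all add: algebra_simps)
    then have "cos (2 * (p * \<theta>)) = 1" using s by (simp add: sin_add)
    then have "sin (p * \<theta>) = 0" by (simp add: cos_double_sin)
    moreover have "0 < p * \<theta>" "p * \<theta> < pi"
      using assms(4,5) n enat by (simp_all add: \<theta>_def field_simps)
    ultimately show False using sin_gt_zero by fastforce
  next
    case infinity
    then have "cartan i j = - (5 / 2)" using assms(3) by (simp add: cartan_def)
    \<comment> \<open>The numbers 2 and 1/2 are the roots of \<open>t^2 - (5/2) * t + 1\<close>, the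
      characteristic polynomial for the infinite label.\<close>
    moreover have "2 ^ Suc (Suc k) - (1 / 2) ^ Suc (Suc k) =
        5 / 2 * (2 ^ Suc k - (1 / 2) ^ Suc k) - (2 ^ k - (1 / 2) ^ k :: real)" for k
      by (simp add: field_simps)
    moreover have "(5 / 2 :: real)\<^sup>2 \<noteq> 4" by (simp add: power2_eq_square)
    ultimately have "(2 :: real) ^ (2 * p) - (1 / 2) ^ (2 * p) = 2 ^ 0 - (1 / 2) ^ 0"
      using key[where x = "\<lambda>k. 2 ^ k - (1 / 2) ^ k" and c = "5 / 2"] by blast
    then have "(2 :: real) ^ (2 * p) = (1 / 2) ^ (2 * p)" by simp
    moreover have "(1 :: real) < 2 ^ (2 * p)" using assms(4) by (intro one_less_power) auto
    moreover have "(1 / 2 :: real) ^ (2 * p) \<le> 1" by (intro power_le_one) auto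
    ultimately show False by linarith
  qed
qed

subsection \<open>Matsumoto's theorem and Tits' theorem\<close>

text \<open>Induction on \<open>p\<close> with \<open>i\<close> and \<open>j\<close> exchanged: take
  a word of the element that starts with the alternating word of length \<open>p\<close> in
  \<open>j\<close>, \<open>i\<close>, and apply the exchange condition for \<open>i\<close>. The
  deleted letter cannot lie in the alternating prefix, so the prefix grows by
  \<open>i\<close>.\<close>

lemma descents_alternating:
  assumes "reduced w" and "i \<in> I" "j \<in> I" "i \<noteq> j"
    and "inversion_parity w [i]" "inversion_parity w [j]" and "enat p \<le> m i j"
  shows "\<exists>x. alternating p i j @ x \<approx> w \<and> length (alternating p i j @ x) = length w"
  using assms(2-)
proof (induction p arbitrary: i j)
  case 0
  show ?case by (intro exI[of _ w]) (simp add: word_cong.refl)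
next
  case (Suc p)
  have mji: "m j i = m i j" using coxeter_matrix Suc.prems by (auto simp: coxeter_matrix_def)
  have p: "enat p < m i j" using Suc.prems(6) by (metis Suc_ile_eq)
  obtain x where x: "alternating p j i @ x \<approx> w" "length (alternating p j i @ x) = length w"
    using Suc.IH[of j i] Suc.prems less_imp_le[OF p] mji by metis
  let ?v = "alternating p j i @ x"
  have v: "?v \<in> lists I" using cong_lists[OF x(1)] assms(1) by (simp add: reduced_def)
  have "inversion_parity ?v [i]" using inversion_parity_cong[OF x(1)] Suc.prems(4) by simp
  then obtain a k b where split: "?v = a @ k # b" and c: "[i] \<approx> a @ [k] @ rev a"
    using inversion_parity_imp_conjugate[OF _ v] by blast
  have a: "a \<in> lists I" "k \<in> I" using v split by auto
  have ia: "i # a \<approx> a @ [k]"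
    using c cong_move_right[of "rev a" "a @ [k]" "[i]"] a cong_sym by auto
  show ?case
  proof (cases "length a < p")
    \<comment> \<open>A deletion within the prefix would give a braid identity of length
      \<open>Suc (length a) \<le> p < m i j\<close>.\<close>
    case True
    then have "take (Suc (length a)) (alternating p j i) = a @ [k]"
      using split by (metis append_eq_append_conv_if append_Cons append_Nil append_assoc length_append_singleton length_alternating Suc_leI)
    moreover obtain q where q: "p = Suc (length a) + q" using True by (metis less_iff_Suc_add add_Suc)
    ultimately have ak: "alternating (Suc (length a)) j i = a @ [k]"
      unfolding q alternating_add by simp
    then have "alternating (length a) j i = a"
      using alternating_add[of "length a" 1 j i] by simp
    then have "alternating (Suc (length a)) i j \<approx> alternating (Suc (length a)) j i"
      using ia ak by (metis alternating.simps(2))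
    moreover have "enat (Suc (length a)) < m i j"
      using True p by (meson Suc_leI enat_ord_simps(1) le_less_trans)
    ultimately show ?thesis using alternating_not_cong Suc.prems by blast
  next
    case False
    then obtain a' where a': "a = alternating p j i @ a'"
      using split by (metis append_eq_append_conv2 append_eq_append_conv_if length_alternating linorder_not_less append_take_drop_id)
    have "i # a @ b \<approx> a @ k # b" using word_cong.append[OF ia word_cong.refl, of b] by simp
    then have "alternating (Suc p) i j @ (a' @ b) \<approx> w"
      using cong_trans x(1) split a' by simp
    moreover have "length (alternating (Suc p) i j @ (a' @ b)) = length w"
      using x(2) split a' by simp
    ultimately show ?thesis by blast
  qed
qed

text \<open>Words with the same first letter are handled by induction on the length. If the first
  letters differ, both are descents, so the element has words starting with either side of a braid
  relation and agreeing afterwards; each is compared with \<open>u\<close> or \<open>v\<close>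
  through the common first letter.\<close>

theorem matsumoto:
  assumes "reduced u" "reduced v" "u \<approx> v"
  shows "braid_cong I m u v"
  using assms
proof (induction "length u" arbitrary: u v)
  case 0
  then have "length v \<le> length u" unfolding reduced_def by blast
  then show ?case using 0 by (simp add: word_cong.refl)
next
  case (Suc l)
  have len: "length v = length u"
    using Suc.prems cong_sym unfolding reduced_def by (meson le_antisym)
  obtain i u' where u: "u = i # u'" using Suc.hyps(2) by (cases u) auto
  obtain j v' where v: "v = j # v'" using Suc.hyps(2) len by (cases v) auto
  have ij: "i \<in> I" "j \<in> I" using Suc.prems u v by (auto simp: reduced_def)
  have same_head: "braid_cong I m (k # x) (k # y)"
    if "reduced (k # x)" "reduced (k # y)" "k # x \<approx> k # y" "length x = l" for k x y
  proof -
    have "x \<approx> y" using cong_cancel_left[of "[k]" x y] that by (auto simp: reduced_def)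
    then show ?thesis
      using Suc.hyps(1)[of x y] reduced_appendD(2)[of "[k]"] that word_cong_Cons by auto
  qed
  show ?case
  proof (cases "i = j")
    case True
    then show ?thesis using same_head Suc u v by simp
  next
    case False
    have "inversion_parity u [i]" using inversion_parity_reduced_Cons Suc.prems(1) u by blast
    moreover have "inversion_parity u [j]"
      using inversion_parity_reduced_Cons Suc.prems(2) v inversion_parity_cong[OF Suc.prems(3)] by blast
    ultimately have desc: "\<exists>x. alternating p i j @ x \<approx> u \<and> length (alternating p i j @ x) = length u"
      if "enat p \<le> m i j" for p
      using descents_alternating[OF Suc.prems(1) ij False] that by blast
    have "m i j \<noteq> \<infinity>"
    proof
      assume "m i j = \<infinity>"
      \<comment> \<open>An infinite label would allow an alternating prefix longer than
        \<open>u\<close> itself.\<close>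
      then show False using desc[of "Suc (length u)"] by auto
    qed
    then obtain n where n: "m i j = enat n" by blast
    obtain k where k: "n = Suc k" using coxeter_matrix_ge_2[OF coxeter_matrix ij n] by (cases n) auto
    obtain x where x: "alternating n i j @ x \<approx> u" "length (alternating n i j @ x) = length u"
      using desc n by auto
    have rel: "braid_cong I m (alternating n i j @ x) (alternating n j i @ x)"
      using ij n False by (intro word_cong.append word_cong.refl word_cong.relation)
        (auto simp: braid_relations_def)
    have x': "alternating n j i @ x \<approx> v"
      using braid_imp_cong[OF rel] x(1) Suc.prems(3) cong_sym cong_trans by blast
    have "braid_cong I m u (alternating n i j @ x)"
    proof -
      have "reduced (alternating n i j @ x)" using reduced_cong[OF Suc.prems(1) x(1)] x(2) by simp
      then show ?thesis
        using same_head[of i u' "alternating k j i @ x"] Suc.prems(1) Suc.hyps(2) cong_sym[OF x(1)]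
        unfolding u k by simp
    qed
    moreover have "braid_cong I m (alternating n j i @ x) v"
    proof -
      have "reduced (alternating n j i @ x)"
        using reduced_cong[OF Suc.prems(2) x'] x(2) len by simp
      moreover have "length (alternating k i j @ x) = l" using x(2) Suc.hyps(2) k by simp
      ultimately show ?thesis
        using same_head[of j "alternating k i j @ x" v'] Suc.prems(2) x' unfolding v k by simp
    qed
    ultimately show ?thesis using rel word_cong.trans by blast
  qed
qed

text \<open>If \<open>u\<close> is reduced and \<open>i # u\<close> is not, then \<open>u\<close>
  has a reduced word starting with \<open>i\<close>. Matsumoto's theorem reaches it by braid moves,
  and so the square \<open>i i\<close> appears in \<open>i # u\<close>.\<close>

theorem nonvanishing_imp_reduced:
  assumes "\<forall>i\<in>I. d i = 2" "w \<in> lists I" "\<not> vanishing I m d w"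
  shows "reduced w"
  using assms(2,3)
proof (induction w)
  case Nil
  then show ?case by (simp add: reduced_def)
next
  case (Cons i u)
  have "\<not> vanishing I m d u" using Cons.prems vanishing_append[of I m d u "[i]" "[]"] by auto
  then have u: "reduced u" using Cons by simp
  have i: "i \<in> I" using Cons by simp
  show ?case
  proof (rule ccontr)
    assume "\<not> reduced (i # u)"
    then obtain v' where v': "v' \<approx> i # u" "length v' < length (i # u)"
      using Cons.hyps i unfolding reduced_def by fastforce
    obtain v where v: "reduced v" "v \<approx> i # u" using exists_reduced[of "i # u"] i Cons.hyps by auto
    have "length v \<le> length v'" using v v'(1) cong_sym cong_trans unfolding reduced_def by blast
    \<comment> \<open>Parity excludes equal lengths of \<open>v\<close> and \<open>u\<close>, so
      \<open>i # v\<close> is no longer than \<open>u\<close>.\<close>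
    moreover have "even (length v) \<longleftrightarrow> odd (length u)" using cong_parity[OF v(2)] by simp
    ultimately have len: "length (i # v) \<le> length u"
      using v'(2) by (cases "length v = length u") auto
    have "i # v \<approx> i # i # u" using word_cong_Cons[OF v(2)] .
    also have "i # i # u \<approx> u" using cong_delete_square[OF i, of "[]" u] by simp
    finally have iv: "i # v \<approx> u" .
    have "braid_cong I m u (i # v)"
      by (rule matsumoto[OF u reduced_cong[OF u iv len] cong_sym[OF iv]])
    then have "braid_cong I m (i # u) ([] @ replicate (d i) i @ v)"
      using assms(1) i word_cong_Cons by (fastforce simp: numeral_2_eq_2)
    then show False using Cons.prems i unfolding vanishing_def by blast
  qed
qed

lemma reduced_imp_nonvanishing:
  assumes "\<forall>i\<in>I. d i = 2" "reduced w"
  shows "w \<in> nonvanishing_words I m d"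
proof -
  have False if i: "i \<in> I" and b: "braid_cong I m w (u @ replicate (d i) i @ v)" for u i v
  proof -
    have "w \<approx> u @ i # i # v" using braid_imp_cong[OF b] assms(1) i by (simp add: numeral_2_eq_2)
    also have "\<dots> \<approx> u @ v" by (rule cong_delete_square[OF i])
    finally have "length w \<le> length (u @ v)" using assms(2) cong_sym unfolding reduced_def by blast
    then show False using braid_cong_length[OF b] assms(1) i by simp
  qed
  then show ?thesis using assms(2) unfolding nonvanishing_words_def vanishing_def reduced_def by blast
qed

subsection \<open>Finite Coxeter groups\<close>

abbreviation pres (infix "\<sim>" 50) where
  "u \<sim> v \<equiv> presentation_cong I (coxeter_relations I m) u v"

abbreviation positive :: "'i list \<Rightarrow> ('i \<times> bool) list" where
  "positive w \<equiv> map (\<lambda>i. (i, True)) w"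

text \<open>Forgetting the signs of the letters turns \<open>cancel\<close> into the deletion of a
  square and leaves the other relations as they are.\<close>

lemma pres_imp_cong:
  assumes "u \<sim> v"
  shows "map fst u \<approx> map fst v"
  using assms
proof induction
  case (cancel a b)
  then show ?case by (simp add: cong_square)
next
  case (relation u v)
  then show ?case unfolding coxeter_relations_def
  proof (elim UnE)
    assume "(u, v) \<in> {([(i, True), (i, True)], []) | i. i \<in> I}"
    then show ?thesis by (auto simp: cong_square)
  next
    assume "(u, v) \<in> {(alternating n (i, True) (j, True), alternating n (j, True) (i, True)) | i j n.
      i \<in> I \<and> j \<in> I \<and> i \<noteq> j \<and> m i j = enat n}"
    then obtain i j n where ij: "i \<in> I" "j \<in> I" "i \<noteq> j" "m i j = enat n"
      and uv: "u = alternating n (i, True) (j, True)" "v = alternating n (j, True) (i, True)" by auto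
    show ?thesis unfolding uv map_alternating fst_conv
      by (rule braid_imp_cong[OF word_cong.relation[OF braid_relationsI[where m = m, OF ij]]])
  qed
qed (auto intro: word_cong.intros)

lemma cong_imp_pres:
  assumes "u \<approx> v" "u \<in> lists I"
  shows "positive u \<sim> positive v"
  using assms
proof induction
  case (refl w)
  then show ?case by (intro presentation_cong.refl) auto
next
  case (sym u v)
  then show ?case using cong_lists presentation_cong.sym by blast
next
  case (trans u v w)
  then show ?case using cong_lists presentation_cong.trans by blast
next
  case (append u u' v v')
  then show ?case using presentation_cong.append by auto
next
  case (relation u v)
  then have "v \<in> lists I" using cong_lists word_cong.relation by blast
  moreover have "(positive u, positive v) \<in> coxeter_relations I m"
    using relation.hyps unfolding coxeter_word_relations_def
  proof (elim UnE)
    assume "(u, v) \<in> {([i, i], []) | i. i \<in> I}"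
    then show ?thesis unfolding coxeter_relations_def by auto
  next
    assume "(u, v) \<in> braid_relations I m"
    then obtain i j n where "i \<in> I" "j \<in> I" "i \<noteq> j" "m i j = enat n"
      and uv: "u = alternating n i j" "v = alternating n j i" by (elim braid_relationsE)
    then show ?thesis unfolding uv map_alternating coxeter_relations_def by blast
  qed
  ultimately show ?case using relation.prems by (intro presentation_cong.relation) auto
qed

lemma pres_positive:
  assumes "w \<in> lists (I \<times> UNIV)"
  shows "w \<sim> positive (map fst w)"
  using assms
proof (induction w)
  case Nil
  then show ?case by (simp add: presentation_cong.refl)
next
  case (Cons x w)
  obtain a b where x: "x = (a, b)" by (cases x)
  have a: "a \<in> I" using Cons.hyps x by auto
  have aI: "[(a, b)] \<in> lists (I \<times> UNIV)" for b :: bool using a by simp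
  have "[(a, b)] \<sim> [(a, True)]"
  proof (cases b)
    case True
    then show ?thesis using presentation_cong.refl[OF aI] by simp
  next
    case False
    have sq: "[(a, True), (a, True)] \<sim> []"
      using a by (intro presentation_cong.relation) (auto simp: coxeter_relations_def)
    \<comment> \<open>The inverse of \<open>a\<close> followed by \<open>a a\<close> is simplified
      in two ways, which gives that the inverse of \<open>a\<close> is \<open>a\<close>.\<close>
    have "[(a, False)] @ [(a, True), (a, True)] \<sim> [(a, False)] @ []"
      by (intro presentation_cong.append presentation_cong.refl aI sq)
    moreover have "[(a, False), (a, True)] @ [(a, True)] \<sim> [] @ [(a, True)]"
      using presentation_cong.cancel[OF a, of _ False]
      by (intro presentation_cong.append presentation_cong.refl aI) auto
    ultimately show ?thesis using False presentation_cong.sym presentation_cong.trans by fastforce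
  qed
  then have "[(a, b)] @ w \<sim> [(a, True)] @ positive (map fst w)"
    using Cons by (intro presentation_cong.append) auto
  then show ?case by (simp add: x)
qed

definition element :: "'i list \<Rightarrow> ('i \<times> bool) list set" where
  "element w = {v. positive w \<sim> v}"

lemma element_eq_iff:
  assumes "u \<in> lists I" "v \<in> lists I"
  shows "element u = element v \<longleftrightarrow> u \<approx> v"
proof
  assume "element u = element v"
  moreover have "positive v \<in> element v"
    unfolding element_def using assms(2) by (auto intro!: presentation_cong.refl)
  ultimately have "positive u \<sim> positive v" by (auto simp: element_def)
  from pres_imp_cong[OF this] show "u \<approx> v" by (simp add: comp_def)
next
  assume "u \<approx> v"
  then have "positive u \<sim> positive v" using assms(1) by (rule cong_imp_pres)
  then show "element u = element v"
    unfolding element_def using presentation_cong.sym presentation_cong.trans by blast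
qed

lemma carrier_coxeter_group: "carrier (coxeter_group I m) = element ` lists I"
proof -
  have carr: "carrier (coxeter_group I m) = (\<lambda>w. {v. w \<sim> v}) ` lists (I \<times> UNIV)"
    by (auto simp: coxeter_group_def presented_group_def quotient_def)
  have cls: "{v. w \<sim> v} = element (map fst w)" if "w \<in> lists (I \<times> UNIV)" for w
    unfolding element_def
    using pres_positive[OF that] presentation_cong.sym presentation_cong.trans by blast
  have fst: "map fst w \<in> lists I" if "w \<in> lists (I \<times> UNIV)" for w :: "('i \<times> bool) list"
    using that by fastforce
  have pos: "positive w \<in> lists (I \<times> UNIV)" if "w \<in> lists I" for w
    using that by auto
  show ?thesis unfolding carr
  proof (intro equalityI image_subsetI)
    fix w assume w: "w \<in> lists (I \<times> (UNIV :: bool set))"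
    show "{v. w \<sim> v} \<in> element ` lists I" unfolding cls[OF w] using fst[OF w] by (rule imageI)
  next
    fix w assume w: "w \<in> lists I"
    have "element w = {v. positive w \<sim> v}" by (simp add: element_def)
    then show "element w \<in> (\<lambda>w. {v. w \<sim> v}) ` lists (I \<times> UNIV)" using pos[OF w] by (rule image_eqI)
  qed
qed

text \<open>The prefixes of a reduced word are reduced of different lengths, hence represent
  different elements; this bounds the length by the order of \<open>W\<close>. Conversely, every
  element has a reduced word, which is nonvanishing.\<close>

theorem finite_coxeter_group_iff:
  assumes "\<forall>i\<in>I. d i = 2"
  shows "finite (carrier (coxeter_group I m)) \<longleftrightarrow> finite (nonvanishing_words I m d)"
proof
  assume fin: "finite (carrier (coxeter_group I m))"
  have "length w \<le> card (carrier (coxeter_group I m))" if "w \<in> nonvanishing_words I m d" for w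
  proof -
    have w: "reduced w"
      using that nonvanishing_imp_reduced[OF assms] by (auto simp: nonvanishing_words_def)
    have "inj_on (\<lambda>k. element (take k w)) {..length w}"
    proof (rule inj_onI)
      fix k l assume kl: "k \<in> {..length w}" "l \<in> {..length w}"
        "element (take k w) = element (take l w)"
      have "reduced (take k w)" "reduced (take l w)"
        using w reduced_appendD(1)[of "take k w" "drop k w"] reduced_appendD(1)[of "take l w" "drop l w"]
        by simp_all
      moreover from this have "take k w \<approx> take l w"
        using kl(3) element_eq_iff by (auto simp: reduced_def)
      ultimately have "length (take k w) = length (take l w)"
        using cong_sym unfolding reduced_def by (meson le_antisym)
      then show "k = l" using kl by simp
    qed
    moreover have "(\<lambda>k. element (take k w)) ` {..length w} \<subseteq> carrier (coxeter_group I m)"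
      using w by (auto simp: carrier_coxeter_group reduced_def dest!: in_set_takeD)
    ultimately have "card {..length w} \<le> card (carrier (coxeter_group I m))"
      using fin by (meson card_inj_on_le)
    then show ?thesis by simp
  qed
  then show "finite (nonvanishing_words I m d)"
    using finite_nonvanishing_words_iff coxeter_matrix by (metis coxeter_matrix_def)
next
  assume fin: "finite (nonvanishing_words I m d)"
  have "carrier (coxeter_group I m) \<subseteq> element ` nonvanishing_words I m d"
  proof
    fix X assume "X \<in> carrier (coxeter_group I m)"
    then obtain w where w: "w \<in> lists I" "X = element w" by (auto simp: carrier_coxeter_group)
    obtain v where v: "reduced v" "v \<approx> w" using exists_reduced[OF w(1)] by blast
    have "X = element v"
      using element_eq_iff[of v w] v w by (auto simp: reduced_def)
    then show "X \<in> element ` nonvanishing_words I m d"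
      using reduced_imp_nonvanishing[OF assms v(1)] by blast
  qed
  then show "finite (carrier (coxeter_group I m))" using fin finite_surj by blast
qed

end

section \<open>Type A with one exceptional end\<close>

definition A_matrix :: "nat \<Rightarrow> nat \<Rightarrow> enat" where
  "A_matrix a b = (if a = b + 1 \<or> b = a + 1 then enat 3 else enat 2)"

definition end_exponent :: "nat \<Rightarrow> nat \<Rightarrow> nat \<Rightarrow> nat" where
  "end_exponent n D a = (if a = n then D else 2)"

abbreviation A_cong :: "nat \<Rightarrow> nat list \<Rightarrow> nat list \<Rightarrow> bool" where
  "A_cong n \<equiv> braid_cong {1..n} A_matrix"

text \<open>The upper end is excluded because the letters \<open>n\<close> form a block of their own
  in the normal form; \<open>desc n n\<close> is empty.\<close>

abbreviation desc :: "nat \<Rightarrow> nat \<Rightarrow> nat list" where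
  "desc p n \<equiv> rev [p..<n]"

section \<open>Commutations, braid moves and descending runs in type A\<close>

lemma A_cong_commute:
  assumes "a \<in> {1..n}" "b \<in> {1..n}" "a + 2 \<le> b"
  shows "A_cong n [b, a] [a, b]"
proof -
  have "(alternating 2 b a, alternating 2 a b) \<in> braid_relations {1..n} A_matrix"
    using assms by (intro braid_relationsI) (auto simp: A_matrix_def)
  then show ?thesis by (intro word_cong.relation) (simp add: numeral_2_eq_2)
qed

lemma A_cong_braid:
  assumes "a \<in> {1..n}" "Suc a \<in> {1..n}"
  shows "A_cong n [Suc a, a, Suc a] [a, Suc a, a]"
proof -
  have "(alternating 3 (Suc a) a, alternating 3 a (Suc a)) \<in> braid_relations {1..n} A_matrix"
    using assms by (intro braid_relationsI) (auto simp: A_matrix_def)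
  then show ?thesis by (intro word_cong.relation) (simp add: numeral_3_eq_3)
qed

lemma A_cong_move_left:
  assumes "a \<in> {1..n}" "\<forall>b\<in>set w. b \<in> {1..n} \<and> a + 2 \<le> b"
  shows "A_cong n (w @ [a]) (a # w)"
  using assms(2)
proof (induction w)
  case (Cons b w)
  have "A_cong n (b # w @ [a]) (b # a # w)" using Cons by (intro word_cong_Cons) simp
  moreover have "A_cong n ([b, a] @ w) ([a, b] @ w)"
    using Cons.prems assms(1) by (intro word_cong.append word_cong.refl A_cong_commute) auto
  ultimately show ?case using word_cong.trans by fastforce
qed (simp add: word_cong.refl)

lemma A_cong_move_right:
  assumes "a \<in> {1..n}" "\<forall>b\<in>set w. b \<in> {1..n} \<and> b + 2 \<le> a"
  shows "A_cong n (w @ [a]) (a # w)"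
  using assms(2)
proof (induction w)
  case (Cons b w)
  have "A_cong n (b # w @ [a]) (b # a # w)" using Cons by (intro word_cong_Cons) simp
  moreover have "A_cong n ([b, a] @ w) ([a, b] @ w)"
    using Cons.prems assms(1)
    by (intro word_cong.append word_cong.refl word_cong.sym[OF A_cong_commute]) auto
  ultimately show ?case using word_cong.trans by fastforce
qed (simp add: word_cong.refl)

lemma desc_split: "p \<le> q \<Longrightarrow> q \<le> n \<Longrightarrow> desc p n = desc q n @ desc p q"
  by (metis le_Suc_ex rev_append upt_add_eq_append)

lemma desc_snoc: "p < n \<Longrightarrow> desc p n = desc (Suc p) n @ [p]"
  by (simp add: upt_conv_Cons)

lemma desc_Cons: "p < n \<Longrightarrow> desc p n = (n - 1) # desc p (n - 1)"
  by (cases n) auto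

text \<open>For \<open>D = 2\<close> this is the factorization of a permutation into an element of
  the smaller symmetric group and a coset representative \<open>n (n - 1) ... p\<close>. A larger
  \<open>D\<close> allows further copies of \<open>n\<close> in front.\<close>

definition A_normal :: "nat \<Rightarrow> nat \<Rightarrow> nat list \<Rightarrow> bool" where
  "A_normal n D w \<longleftrightarrow> (\<exists>w' k p. w' \<in> lists {1..n - 1} \<and> k < D \<and> p \<in> {1..n} \<and>
     w = w' @ replicate k n @ (if k = 0 then [] else desc p n))"

text \<open>The cases compare \<open>a\<close> with the end \<open>p\<close> of the run. Below
  \<open>p - 1\<close> it commutes into \<open>w'\<close>; \<open>p - 1\<close> prolongs the run;
  \<open>p\<close> either repeats a letter of exponent 2 or, for \<open>p = n\<close>, adds a letter
  \<open>n\<close>; a letter above \<open>p\<close> passes through the run by a braid move.\<close>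

lemma A_normal_snoc:
  assumes "1 \<le> n" "2 \<le> D" "A_normal n D w" "a \<in> {1..n}"
  shows "vanishing {1..n} A_matrix (end_exponent n D) (w @ [a]) \<or>
    (\<exists>v. A_normal n D v \<and> A_cong n (w @ [a]) v)"
proof -
  let ?van = "vanishing {1..n} A_matrix (end_exponent n D)"
  have van: "?van v" if "A_cong n v (x @ [i, i] @ y)" "i \<in> {1..n - 1}" for v x i y
  proof -
    have "[i, i] = replicate (end_exponent n D i) i"
      using that(2) assms(1) by (auto simp: end_exponent_def numeral_2_eq_2)
    moreover have "i \<in> {1..n}" using that(2) by auto
    ultimately show ?thesis using that(1) vanishingI by metis
  qed
  obtain w' k p where w': "w' \<in> lists {1..n - 1}" and k: "k < D" and p: "p \<in> {1..n}"
    and w: "w = w' @ replicate k n @ (if k = 0 then [] else desc p n)"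
    using assms(3) unfolding A_normal_def by blast
  have normal: "A_normal n D (v @ replicate l n @ desc q n)"
    if "v \<in> lists {1..n - 1}" "l < D" "q \<in> {1..n}" "0 < l" for v l q
    unfolding A_normal_def using that by (intro exI[of _ v] exI[of _ l] exI[of _ q]) simp
  show ?thesis
  proof (cases "k = 0")
    case True
    show ?thesis
    proof (cases "a = n")
      case True
      have "A_normal n D (w' @ replicate 1 n @ desc n n)" using w' assms by (intro normal) auto
      then show ?thesis using w \<open>k = 0\<close> True word_cong.refl by fastforce
    next
      case False
      then have "A_normal n D (w @ [a])"
        unfolding A_normal_def using w \<open>k = 0\<close> w' assms
        by (intro exI[of _ "w' @ [a]"] exI[of _ 0] exI[of _ n]) auto
      then show ?thesis using word_cong.refl by blast
    qed
  next
    case False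
    then obtain l where l: "k = Suc l" by (cases k) auto
    have w: "w = w' @ replicate k n @ desc p n" using w False by simp
    consider "a + 1 < p" | "a + 1 = p" | "a = p" "p = n" | "a = p" "p < n"
      | "p < a" "a < n" | "p < a" "a = n" using assms(4) by force
    then show ?thesis
    proof cases
      case 1
      have "A_cong n ((replicate k n @ desc p n) @ [a]) (a # replicate k n @ desc p n)"
        using 1 assms p by (intro A_cong_move_left) auto
      then have "A_cong n (w' @ (replicate k n @ desc p n) @ [a]) (w' @ a # replicate k n @ desc p n)"
        by (intro word_cong.append word_cong.refl)
      then have "A_cong n (w @ [a]) ((w' @ [a]) @ replicate k n @ desc p n)" by (simp add: w)
      moreover have "A_normal n D ((w' @ [a]) @ replicate k n @ desc p n)"
        using 1 assms p k w' False by (intro normal) auto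
      ultimately show ?thesis by blast
    next
      case 2
      then have "w @ [a] = w' @ replicate k n @ desc a n" using desc_snoc[of a n] p by (simp add: w)
      moreover have "A_normal n D (w' @ replicate k n @ desc a n)"
        using assms k w' False by (intro normal) auto
      ultimately show ?thesis using word_cong.refl by metis
    next
      case 3
      then have wa: "w @ [a] = w' @ replicate (Suc k) n @ desc n n"
        by (simp add: w replicate_app_Cons_same)
      show ?thesis
      proof (cases "Suc k < D")
        case True
        then have "A_normal n D (w @ [a])" unfolding wa using assms w' by (intro normal) auto
        then show ?thesis using word_cong.refl by blast
      next
        case False
        then have "D = Suc k" using k by simp
        then have "w @ [a] = w' @ replicate (end_exponent n D n) n @ []"
          using wa by (simp add: end_exponent_def)
        then have "A_cong n (w @ [a]) (w' @ replicate (end_exponent n D n) n @ [])"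
          using word_cong.refl by metis
        then have "?van (w @ [a])" by (rule vanishingI[rotated]) (use assms(1) in simp)
        then show ?thesis ..
      qed
    next
      case 4
      have "w @ [a] = (w' @ replicate k n @ desc (Suc p) n) @ [p, p] @ []"
        using desc_snoc[of p n] 4 by (simp add: w)
      then have "A_cong n (w @ [a]) ((w' @ replicate k n @ desc (Suc p) n) @ [p, p] @ [])"
        using word_cong.refl by metis
      then have "?van (w @ [a])" by (rule van) (use 4 p in auto)
      then show ?thesis ..
    next
      \<comment> \<open>After commuting past the smaller letters, \<open>a\<close> completes
        \<open>a b a\<close>. The braid move gives \<open>b a b\<close>, and the first
        \<open>b\<close> commutes past all letters from \<open>b + 2\<close> on into
        \<open>w'\<close>.\<close>
      case 5
      then obtain b where b: "a = Suc b" by (cases a) auto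
      let ?x = "replicate k n @ desc (Suc a) n"
      have split: "desc p n = desc (Suc a) n @ [a, b] @ desc p b"
        using desc_split[of p "Suc a" n] desc_Cons[of p "Suc a"] desc_Cons[of p a] 5 b by simp
      have wa: "w @ [a] = (w' @ ?x @ [a, b]) @ (desc p b @ [a])" by (simp add: w split)
      have "A_cong n (desc p b @ [a]) (a # desc p b)"
        using 5 b assms p by (intro A_cong_move_right) auto
      then have 1: "A_cong n (w @ [a]) ((w' @ ?x @ [a, b]) @ (a # desc p b))"
        unfolding wa by (intro word_cong.append[OF word_cong.refl])
      have 2: "A_cong n ((w' @ ?x) @ [Suc b, b, Suc b] @ desc p b) ((w' @ ?x) @ [b, Suc b, b] @ desc p b)"
        using 5 b assms p by (intro word_cong_context A_cong_braid) auto
      have 3: "A_cong n (w' @ (?x @ [b]) @ (a # b # desc p b)) (w' @ (b # ?x) @ (a # b # desc p b))"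
        using 5 b assms p by (intro word_cong_context A_cong_move_left) auto
      have "A_cong n (w @ [a]) ((w' @ ?x) @ [b, Suc b, b] @ desc p b)"
        by (rule word_cong.trans[OF 1]) (use 2 b in simp)
      then have "A_cong n (w @ [a]) (w' @ (b # ?x) @ (a # b # desc p b))"
        by (rule word_cong.trans) (use 3 b in simp)
      then have "A_cong n (w @ [a]) ((w' @ [b]) @ replicate k n @ desc p n)" by (simp add: split)
      moreover have "A_normal n D ((w' @ [b]) @ replicate k n @ desc p n)"
        using 5 b assms p k w' False by (intro normal) auto
      ultimately show ?thesis by blast
    next
      \<comment> \<open>The same braid move gives \<open>b n b\<close>, with the remaining
        \<open>l\<close> letters \<open>n\<close> to its left; \<open>b = n - 1\<close> does not
        commute with them.\<close>
      case 6
      then obtain b where b: "n = Suc b" by (cases n) auto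
      have wa: "w @ [a] = (w' @ replicate l n @ [n, b]) @ (desc p b @ [n])"
        using desc_Cons[of p n] 6 b by (simp add: w l replicate_app_Cons_same)
      have "A_cong n (desc p b @ [n]) (n # desc p b)"
        using 6 b assms p by (intro A_cong_move_right) auto
      then have 1: "A_cong n (w @ [a]) ((w' @ replicate l n @ [n, b]) @ (n # desc p b))"
        unfolding wa by (intro word_cong.append[OF word_cong.refl])
      have 2: "A_cong n ((w' @ replicate l n) @ [Suc b, b, Suc b] @ desc p b)
          ((w' @ replicate l n) @ [b, Suc b, b] @ desc p b)"
        using 6 b assms p by (intro word_cong_context A_cong_braid) auto
      have c: "A_cong n (w @ [a]) ((w' @ replicate l n) @ [b, Suc b, b] @ desc p b)"
        by (rule word_cong.trans[OF 1]) (use 2 b in simp)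
      show ?thesis
      proof (cases l)
        case 0
        have "A_normal n D ((w' @ [b]) @ replicate 1 n @ desc p n)"
          using 6 b assms p w' by (intro normal) auto
        moreover have "(w' @ replicate l n) @ [b, Suc b, b] @ desc p b = (w' @ [b]) @ replicate 1 n @ desc p n"
          using 0 b desc_Cons[of p n] 6 by simp
        ultimately show ?thesis using c by metis
      next
        case (Suc l')
        \<comment> \<open>One more letter \<open>n\<close> on the left allows a second braid move,
          which produces the square \<open>b b\<close> with \<open>b < n\<close>.\<close>
        have 3: "A_cong n ((w' @ replicate l' n) @ [Suc b, b, Suc b] @ (b # desc p b))
          ((w' @ replicate l' n) @ [b, Suc b, b] @ (b # desc p b))"
          using 6 b assms p by (intro word_cong_context A_cong_braid) auto
        have 4: "(w' @ replicate l n) @ [b, Suc b, b] @ desc p b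
            = (w' @ replicate l' n) @ [Suc b, b, Suc b] @ (b # desc p b)"
          using b by (simp add: Suc replicate_app_Cons_same)
        have "A_cong n (w @ [a]) ((w' @ replicate l' n @ [b, Suc b]) @ [b, b] @ desc p b)"
          by (rule word_cong.trans[OF c[unfolded 4]]) (use 3 in simp)
        then have "?van (w @ [a])" by (rule van) (use 6 b p in auto)
        then show ?thesis ..
      qed
    qed
  qed
qed

lemma A_normal_form:
  assumes "1 \<le> n" "2 \<le> D" "w \<in> lists {1..n}"
  shows "vanishing {1..n} A_matrix (end_exponent n D) w \<or> (\<exists>v. A_normal n D v \<and> A_cong n w v)"
  using assms(3)
proof (induction w rule: rev_induct)
  case Nil
  have "A_normal n D []"
    unfolding A_normal_def using assms by (intro exI[of _ "[]"] exI[of _ 0] exI[of _ 1]) auto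
  then show ?case using word_cong.refl by blast
next
  case (snoc a w)
  then have a: "a \<in> {1..n}" and w: "w \<in> lists {1..n}" by auto
  from snoc.IH[OF w] show ?case
  proof (elim disjE exE conjE)
    assume "vanishing {1..n} A_matrix (end_exponent n D) w"
    then show ?thesis using vanishing_append[of _ _ _ w "[]" "[a]"] by simp
  next
    fix v assume v: "A_normal n D v" "A_cong n w v"
    have "A_cong n (w @ [a]) (v @ [a])" by (intro word_cong.append v(2) word_cong.refl)
    then show ?thesis
      using A_normal_snoc[OF assms(1,2) v(1) a] vanishing_braid_cong word_cong.trans by metis
  qed
qed

text \<open>In the normal form of a nonvanishing word, the factor \<open>w'\<close> is nonvanishing
  in the smaller rank, so the induction hypothesis bounds it; the rest is bounded by
  \<open>D\<close> and the rank.\<close>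

lemma nonvanishing_A_bounded:
  assumes "2 \<le> D"
  shows "\<exists>L. \<forall>w \<in> nonvanishing_words {1..n} A_matrix (end_exponent n D). length w \<le> L"
  using assms
proof (induction n arbitrary: D)
  case 0
  then show ?case by (auto simp: nonvanishing_words_def)
next
  case (Suc n)
  \<comment> \<open>The end vertex of the smaller diagram is no longer the exceptional one, so the
    hypothesis is taken with exponent 2 there.\<close>
  obtain L where L: "\<And>w. w \<in> nonvanishing_words {1..n} A_matrix (end_exponent n 2) \<Longrightarrow> length w \<le> L"
    using Suc.IH[of 2] by auto
  have "length w \<le> L + D + Suc n"
    if "w \<in> nonvanishing_words {1..Suc n} A_matrix (end_exponent (Suc n) D)" for w
  proof -
    have w: "w \<in> lists {1..Suc n}" "\<not> vanishing {1..Suc n} A_matrix (end_exponent (Suc n) D) w"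
      using that by (auto simp: nonvanishing_words_def)
    obtain v where v: "A_normal (Suc n) D v" "A_cong (Suc n) w v"
      using A_normal_form[OF _ Suc.prems w(1)] w(2) by auto
    obtain w' k p where w': "w' \<in> lists {1..n}" and k: "k < D"
      and v_eq: "v = w' @ replicate k (Suc n) @ (if k = 0 then [] else desc p (Suc n))"
      using v(1) unfolding A_normal_def by auto
    have "\<not> vanishing {1..n} A_matrix (end_exponent n 2) w'"
    proof
      assume "vanishing {1..n} A_matrix (end_exponent n 2) w'"
      then obtain u i y where i: "i \<in> {1..n}" and c: "A_cong n w' (u @ replicate (end_exponent n 2 i) i @ y)"
        unfolding vanishing_def by blast
      have "A_cong (Suc n) w' (u @ replicate (end_exponent n 2 i) i @ y)"
        using c
      proof (rule word_cong_mono)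
        have "(x, y) \<in> braid_relations {1..Suc n} A_matrix" if "(x, y) \<in> braid_relations {1..n} A_matrix" for x y
          using that by (elim braid_relationsE) (simp, rule braid_relationsI, auto)
        then show "braid_relations {1..n} A_matrix \<subseteq> braid_relations {1..Suc n} A_matrix" by auto
      qed
      moreover have "end_exponent n 2 i = end_exponent (Suc n) D i"
        using i by (auto simp: end_exponent_def)
      moreover have "i \<in> {1..Suc n}" using i by auto
      ultimately have "vanishing {1..Suc n} A_matrix (end_exponent (Suc n) D) w'"
        unfolding vanishing_def by metis
      then have "vanishing {1..Suc n} A_matrix (end_exponent (Suc n) D) v"
        using vanishing_append[of _ _ _ w' "[]"] v_eq by simp
      then show False using w(2) vanishing_braid_cong[OF v(2)] by blast
    qed
    then have "length w' \<le> L" using w' by (intro L) (simp add: nonvanishing_words_def)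
    moreover have "length w = length v" by (rule braid_cong_length[OF v(2)])
    moreover have "length v \<le> length w' + k + Suc n" by (simp add: v_eq)
    ultimately show ?thesis using k by linarith
  qed
  then show ?case by blast
qed

text \<open>The labelling carries braid moves and forbidden powers from the model on
  \<open>{1..n}\<close> to \<open>I\<close>, so preimages of nonvanishing words are
  nonvanishing.\<close>

lemma type_A_nonvanishing_bounded:
  assumes "type_A_labelling I m n f" and "2 \<le> D"
    and "\<forall>a\<in>{1..n}. d (f a) = end_exponent n D a"
  shows "\<exists>L. \<forall>w \<in> nonvanishing_words I m d. length w \<le> L"
proof -
  have bij: "bij_betw f {1..n} I" using assms(1) by (simp add: type_A_labelling_def)
  have cong: "braid_cong I m (map f u) (map f v)" if "A_cong n u v" for u v
    using that
  proof induction
    case (relation u v)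
    then obtain a b k where ab: "a \<in> {1..n}" "b \<in> {1..n}" "a \<noteq> b" "A_matrix a b = enat k"
      and uv: "u = alternating k a b" "v = alternating k b a" by (elim braid_relationsE)
    have "m (f a) (f b) = A_matrix a b"
      using assms(1) ab(1-3) by (auto simp: type_A_labelling_def A_matrix_def numeral_eq_enat)
    moreover have "f a \<in> I" "f b \<in> I" using bij ab(1,2) bij_betw_apply by fast+
    moreover have "f a \<noteq> f b" using inj_on_contraD[OF bij_betw_imp_inj_on[OF bij] ab(3,1,2)] .
    ultimately show ?case
      unfolding uv map_alternating using ab(4) by (intro word_cong.relation braid_relationsI) auto
  qed (auto intro: word_cong.intros)
  obtain L where L: "\<And>w. w \<in> nonvanishing_words {1..n} A_matrix (end_exponent n D) \<Longrightarrow> length w \<le> L"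
    using nonvanishing_A_bounded[OF assms(2)] by blast
  have "length w \<le> L" if "w \<in> nonvanishing_words I m d" for w
  proof -
    have "w \<in> lists (f ` {1..n})" using that bij by (simp add: nonvanishing_words_def bij_betw_def)
    then obtain u where u: "u \<in> lists {1..n}" "w = map f u" unfolding lists_image by blast
    have "\<not> vanishing {1..n} A_matrix (end_exponent n D) u"
    proof
      assume "vanishing {1..n} A_matrix (end_exponent n D) u"
      then obtain x a y where a: "a \<in> {1..n}"
        and c: "A_cong n u (x @ replicate (end_exponent n D a) a @ y)"
        unfolding vanishing_def by blast
      have "braid_cong I m w (map f x @ replicate (d (f a)) (f a) @ map f y)"
        using cong[OF c] a assms(3) by (simp add: u(2))
      moreover have "f a \<in> I" using bij a bij_betw_apply by fast
      ultimately show False using that unfolding nonvanishing_words_def vanishing_def by blast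
    qed
    then have "length u \<le> L" using u(1) by (intro L) (simp add: nonvanishing_words_def)
    then show ?thesis by (simp add: u(2))
  qed
  then show ?thesis by blast
qed

section \<open>Exponents at least three\<close>

text \<open>\<open>Up a\<close>: the first \<open>a\<close> letters of the path have been read.
  \<open>Mid y\<close>: the first letter of a two-letter middle word has been read and
  \<open>y\<close> is due. \<open>Down b\<close>: \<open>b\<close> letters of the way back
  remain.\<close>

datatype 'i state = Up nat | Mid 'i | Down nat

text \<open>The words read by the automaton from \<^term>\<open>Up 0\<close> back to itself are products of words
  \<open>P X (rev P)\<close>, where \<open>P\<close> is the path \<open>ps\<close> and \<open>X\<close> is \<open>x\<close> for
  \<open>(x, None) \<in> S\<close> and \<open>x y\<close> for \<open>(x, Some y) \<in> S\<close>. The assumptions ensure that no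
  word with an accepting run admits a braid move other than a commutation within \<open>X\<close>, or contains
  a vanishing power of a letter.\<close>

locale path_automaton =
  fixes I :: "'i set" and m :: "'i \<Rightarrow> 'i \<Rightarrow> enat" and d :: "'i \<Rightarrow> nat"
    and ps :: "'i list" and S :: "('i \<times> 'i option) set"
  assumes coxeter_matrix: "coxeter_matrix I m"
    and exponents: "\<forall>i\<in>I. 2 \<le> d i"
    and ps: "ps \<noteq> []" "distinct ps" "set ps \<subseteq> I"
    and hd: "3 \<le> d (ps ! 0)"
    and path: "\<And>a. Suc a < length ps \<Longrightarrow> 3 \<le> m (ps ! a) (ps ! Suc a)"
    and S_I: "\<And>x z. (x, z) \<in> S \<Longrightarrow> x \<in> I"
    and S_nonempty: "S \<noteq> {}"
    and S_last: "\<And>x z. (x, z) \<in> S \<Longrightarrow> x \<noteq> ps ! (length ps - 1) \<and> 3 \<le> m (ps ! (length ps - 1)) x"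
    and S_prev: "\<And>x z. (x, z) \<in> S \<Longrightarrow> 2 \<le> length ps \<Longrightarrow> x \<noteq> ps ! (length ps - 2)"
    and S_None: "\<And>x. (x, None) \<in> S \<Longrightarrow> 4 \<le> m (ps ! (length ps - 1)) x"
    and S_Some: "\<And>x y. (x, Some y) \<in> S \<Longrightarrow> (y, Some x) \<in> S"
    and S_same: "\<And>x. (x, Some x) \<in> S \<Longrightarrow> 3 \<le> d x"
begin

text \<open>The state \<open>Down 0\<close> is replaced by \<open>Up 0\<close>, which closes the
  automaton into a loop.\<close>

inductive tr :: "'i state \<Rightarrow> 'i \<Rightarrow> 'i state \<Rightarrow> bool" where
  up: "a < length ps \<Longrightarrow> tr (Up a) (ps ! a) (Up (Suc a))"
| single: "(x, None) \<in> S \<Longrightarrow> tr (Up (length ps)) x (Down (length ps))"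
| first: "(x, Some y) \<in> S \<Longrightarrow> tr (Up (length ps)) x (Mid y)"
| second: "(x, Some y) \<in> S \<Longrightarrow> tr (Mid y) y (Down (length ps))"
| down: "a < length ps \<Longrightarrow> tr (Down (Suc a)) (ps ! a) (if a = 0 then Up 0 else Down a)"

primrec run :: "'i list \<Rightarrow> 'i state \<Rightarrow> 'i state \<Rightarrow> bool" where
  "run [] s t \<longleftrightarrow> s = t"
| "run (i # w) s t \<longleftrightarrow> (\<exists>s'. tr s i s' \<and> run w s' t)"

lemma run_append: "run (u @ v) s t \<longleftrightarrow> (\<exists>s'. run u s s' \<and> run v s' t)"
  by (induction u arbitrary: s) auto

lemma tr_Up: "tr (Up a) i t \<longleftrightarrow> (a < length ps \<and> i = ps ! a \<and> t = Up (Suc a)) \<or>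
    (a = length ps \<and> ((i, None) \<in> S \<and> t = Down (length ps) \<or> (\<exists>y. (i, Some y) \<in> S \<and> t = Mid y)))"
  by (auto elim: tr.cases intro: tr.intros)

lemma tr_Mid: "tr (Mid y) i t \<longleftrightarrow> i = y \<and> t = Down (length ps) \<and> (\<exists>x. (x, Some y) \<in> S)"
  by (auto elim: tr.cases intro: tr.intros)

lemma tr_Down: "tr (Down b) i t \<longleftrightarrow>
    (\<exists>a. b = Suc a \<and> a < length ps \<and> i = ps ! a \<and> t = (if a = 0 then Up 0 else Down a))"
proof
  assume "tr (Down b) i t"
  then show "\<exists>a. b = Suc a \<and> a < length ps \<and> i = ps ! a \<and> t = (if a = 0 then Up 0 else Down a)"
    by cases simp_all
qed (use tr.down in blast)

lemma m_sym: "i \<in> I \<Longrightarrow> j \<in> I \<Longrightarrow> m i j = m j i"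
  using coxeter_matrix by (auto simp: coxeter_matrix_def)

lemma ps_I: "a < length ps \<Longrightarrow> ps ! a \<in> I"
  using ps(3) by auto

lemma last_index: "length ps = Suc (length ps - 1)"
  using ps(1) by (cases ps) auto

lemma path': "Suc a < length ps \<Longrightarrow> 3 \<le> m (ps ! Suc a) (ps ! a)"
  using path[of a] m_sym[of "ps ! a" "ps ! Suc a"] ps_I by auto

lemma S_last': "(x, z) \<in> S \<Longrightarrow> 3 \<le> m x (ps ! (length ps - 1))"
  using S_last[of x z] S_I[of x z] m_sym[of x "ps ! (length ps - 1)"] ps_I[of "length ps - 1"] last_index
  by auto

lemma ps_nth_eq: "a < length ps \<Longrightarrow> b < length ps \<Longrightarrow> ps ! a = ps ! b \<longleftrightarrow> a = b"
  using ps(2) by (simp add: nth_eq_iff_index_eq)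

text \<open>Letters repeat only where the run turns round, at \<open>ps ! 0\<close> or in a middle
  word \<open>x x\<close>, and there the exponent is at least 3. Steps along the path use labels at
  least 3, and the two letters of a middle word may be exchanged because \<open>S\<close> is
  symmetric.\<close>

lemma two_steps:
  assumes "tr s i s'" "tr s' j t"
  shows "(i = j \<and> 3 \<le> d i) \<or> (i \<noteq> j \<and> 3 \<le> m i j) \<or> (i \<noteq> j \<and> (\<exists>s''. tr s j s'' \<and> tr s'' i t))"
  using assms(1)
proof cases
  case (up a)
  show ?thesis
  proof (cases "Suc a < length ps")
    case True
    then have "j = ps ! Suc a" using assms(2) up by (simp add: tr_Up)
    then show ?thesis using True up path[OF True] ps_nth_eq[of a "Suc a"] by simp
  next
    case False
    then have a: "a = length ps - 1" using up by simp
    then obtain z where "(j, z) \<in> S" using assms(2) up by (auto simp: tr_Up)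
    then show ?thesis using S_last[of j z] up a by auto
  qed
next
  case single
  then have "j = ps ! (length ps - 1)" using assms(2) by (auto simp: tr_Down)
  then show ?thesis using S_last S_last' single by blast
next
  case (first y)
  then have "j = y" "t = Down (length ps)" using assms(2) by (auto simp: tr_Mid)
  then show ?thesis
    using first S_same S_Some[OF first(3)] tr.first tr.second by (cases "i = j") blast+
next
  case (second x)
  then have "j = ps ! (length ps - 1)" using assms(2) by (auto simp: tr_Down)
  then show ?thesis using S_last S_last' S_Some[OF second(3)] second by blast
next
  case (down a)
  show ?thesis
  proof (cases a)
    case 0
    then have "j = ps ! 0" using assms(2) down ps(1) by (simp add: tr_Up)
    then show ?thesis using down 0 hd by simp
  next
    case (Suc b)
    then have "j = ps ! b" using assms(2) down by (simp add: tr_Down)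
    then show ?thesis using down Suc path'[of b] ps_nth_eq[of "Suc b" b] by simp
  qed
qed

text \<open>The pattern \<open>i j i\<close> arises only around a one-letter middle word, with
  \<open>i\<close> the last vertex of the path. The letter read next is a vertex of the path at its
  end or just before it, hence not \<open>j\<close>.\<close>

lemma three_steps:
  assumes "tr s i s1" "tr s1 j s2" "tr s2 i s3"
  shows "i \<noteq> j \<and> 4 \<le> m i j \<and> \<not> tr s3 j t"
  using assms(1)
proof cases
  case (up a)
  show ?thesis
  proof (cases "Suc a < length ps")
    case True
    then have s2: "s2 = Up (Suc (Suc a))" using assms(2) up by (simp add: tr_Up)
    have "False"
    proof (cases "Suc (Suc a) < length ps")
      case True
      then have "i = ps ! Suc (Suc a)" using assms(3) s2 by (simp add: tr_Up)
      then show False using True up ps_nth_eq[of a "Suc (Suc a)"] by simp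
    next
      case False
      then have a: "length ps - 2 = a" "2 \<le> length ps" using \<open>Suc a < length ps\<close> by simp_all
      then obtain z where "(i, z) \<in> S" using assms(3) s2 False by (auto simp: tr_Up)
      then show False using S_prev[of i z] a up by simp
    qed
    then show ?thesis ..
  next
    case False
    then have a: "length ps = Suc a" using up by simp
    then have *: "(j, None) \<in> S \<and> s2 = Down (length ps) \<or> (\<exists>y. (j, Some y) \<in> S \<and> s2 = Mid y)"
      using assms(2) up by (simp add: tr_Up)
    have "s2 \<noteq> Mid y" if "(j, Some y) \<in> S" for y
    proof
      assume "s2 = Mid y"
      then have "i = y" using assms(3) by (simp add: tr_Mid)
      then show False using S_last[OF S_Some[OF that]] up a by simp
    qed
    then have j: "(j, None) \<in> S" and s2: "s2 = Down (length ps)" using * by auto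
    have s3: "s3 = (if a = 0 then Up 0 else Down a)" using assms(3) s2 a by (simp add: tr_Down)
    have "\<not> tr s3 j t"
    proof
      assume t: "tr s3 j t"
      show False
      proof (cases a)
        case 0
        then have "j = ps ! 0" using t s3 ps(1) by (simp add: tr_Up)
        then show False using S_last[OF j] a 0 by simp
      next
        case (Suc b)
        then have "j = ps ! b" using t s3 by (simp add: tr_Down)
        then show False using S_prev[OF j] a Suc by simp
      qed
    qed
    then show ?thesis using S_last[OF j] S_None[OF j] up a by auto
  qed
next
  case single
  obtain a where a: "length ps = Suc a" using last_index by blast
  have s2: "s2 = (if a = 0 then Up 0 else Down a)" using assms(2) single a by (simp add: tr_Down)
  have False
  proof (cases a)
    case 0
    then have "i = ps ! 0" using assms(3) s2 ps(1) by (simp add: tr_Up)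
    then show False using S_last[OF single(3)] a 0 by simp
  next
    case (Suc b)
    then have "i = ps ! b" using assms(3) s2 by (simp add: tr_Down)
    then show False using S_prev[OF single(3)] a Suc by simp
  qed
  then show ?thesis ..
next
  case (first y)
  obtain a where a: "length ps = Suc a" using last_index by blast
  have "s2 = Down (length ps)" using assms(2) first by (simp add: tr_Mid)
  then have "i = ps ! a" using assms(3) a by (simp add: tr_Down)
  then show ?thesis using S_last[OF first(3)] a by simp
next
  case (second x)
  obtain a where a: "length ps = Suc a" using last_index by blast
  have s2: "s2 = (if a = 0 then Up 0 else Down a)" using assms(2) second a by (simp add: tr_Down)
  have i: "(i, Some x) \<in> S" using S_Some[OF second(3)] second by simp
  have False
  proof (cases a)
    case 0
    then have "i = ps ! 0" using assms(3) s2 ps(1) by (simp add: tr_Up)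
    then show False using S_last[OF i] a 0 by simp
  next
    case (Suc b)
    then have "i = ps ! b" using assms(3) s2 by (simp add: tr_Down)
    then show False using S_prev[OF i] a Suc by simp
  qed
  then show ?thesis ..
next
  case (down a)
  have False
  proof (cases a)
    case 0
    then have "s2 = Up (Suc 0)" using assms(2) down ps(1) by (simp add: tr_Up)
    show False
    proof (cases "length ps = 1")
      case True
      then obtain z where z: "(i, z) \<in> S" using assms(3) \<open>s2 = Up (Suc 0)\<close> by (auto simp: tr_Up)
      then show False using S_last[OF z] True down 0 by simp
    next
      case False
      then have "i = ps ! Suc 0" "Suc 0 < length ps"
        using assms(3) \<open>s2 = Up (Suc 0)\<close> by (auto simp: tr_Up)
      then show False using down 0 ps_nth_eq[of 0 "Suc 0"] ps(1) by simp
    qed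
  next
    case (Suc b)
    then have s2: "s2 = (if b = 0 then Up 0 else Down b)" using assms(2) down by (simp add: tr_Down)
    show False
    proof (cases b)
      case 0
      then have "i = ps ! 0" using assms(3) s2 ps(1) by (simp add: tr_Up)
      then show False using down Suc ps_nth_eq[of 0 a] ps(1) by simp
    next
      case (Suc c)
      then have "i = ps ! c" using assms(3) s2 by (simp add: tr_Down)
      then show False using down \<open>a = Suc b\<close> Suc ps_nth_eq[of c a] by simp
    qed
  qed
  then show ?thesis ..
qed

text \<open>A run never reads a side of a braid relation of length 3 or more: three alternating
  letters force a label at least 4, and then the fourth letter fails. Only commutations remain, and
  they are covered by \<open>two_steps\<close>.\<close>

lemma run_alternating:
  assumes "i \<in> I" "j \<in> I" "i \<noteq> j" "m i j = enat n" "run (alternating n i j) s t"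
  shows "run (alternating n j i) s t"
proof -
  have n: "2 \<le> n" by (rule coxeter_matrix_ge_2[OF coxeter_matrix assms(1,2,4)])
  then obtain l where l: "n = Suc (Suc l)" by (metis add_2_eq_Suc le_Suc_ex)
  obtain s1 s2 where s: "tr s i s1" "tr s1 j s2" "run (alternating l i j) s2 t"
    using assms(5) by (auto simp: l)
  show ?thesis
  proof (cases l)
    case 0
    then have "\<not> 3 \<le> m i j" using assms(4) l by (simp add: numeral_eq_enat)
    then show ?thesis using two_steps[OF s(1,2)] assms(3) s(3) 0 l by auto
  next
    case (Suc k)
    then obtain s3 where s3: "tr s2 i s3" "run (alternating k j i) s3 t" using s by auto
    have three: "4 \<le> m i j" "\<And>t. \<not> tr s3 j t" using three_steps[OF s(1,2) s3(1)] by blast+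
    then obtain k' where "k = Suc k'" using assms(4) l Suc by (cases k) (auto simp: numeral_eq_enat)
    then show ?thesis using three s3 by auto
  qed
qed

lemma run_cong:
  assumes "braid_cong I m u v"
  shows "run u s t \<longleftrightarrow> run v s t"
  using assms
proof (induction arbitrary: s t)
  case (append u u' v v')
  then show ?case by (simp add: run_append)
next
  case (relation u v)
  then obtain i j n where ij: "i \<in> I" "j \<in> I" "i \<noteq> j" "m i j = enat n"
    and uv: "u = alternating n i j" "v = alternating n j i" by (elim braid_relationsE)
  show ?case unfolding uv
    using run_alternating[OF ij] run_alternating[of j i n] ij m_sym[of i j] by metis
qed auto

text \<open>A letter that occurs twice in a row has exponent at least 3, by
  \<open>two_steps\<close>, and no letter occurs three times in a row, by
  \<open>three_steps\<close>.\<close>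

lemma not_run_power:
  assumes "i \<in> I"
  shows "\<not> run (replicate (d i) i) s t"
proof
  assume r: "run (replicate (d i) i) s t"
  have "2 \<le> d i" using exponents assms by blast
  then obtain l where l: "d i = Suc (Suc l)" by (metis add_2_eq_Suc le_Suc_ex)
  obtain s1 s2 where s: "tr s i s1" "tr s1 i s2" "run (replicate l i) s2 t" using r by (auto simp: l)
  then obtain k where "l = Suc k" using two_steps[OF s(1,2)] l by (cases l) auto
  then obtain s3 where "tr s2 i s3" using s by auto
  then show False using three_steps[OF s(1,2)] by blast
qed

lemma run_imp_nonvanishing:
  assumes "run w s t"
  shows "\<not> vanishing I m d w"
proof
  assume "vanishing I m d w"
  then obtain u i v where i: "i \<in> I" and c: "braid_cong I m w (u @ replicate (d i) i @ v)"
    unfolding vanishing_def by blast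
  then have "run (u @ replicate (d i) i @ v) s t" using run_cong assms by blast
  then show False using not_run_power[OF i] by (auto simp: run_append)
qed

lemma run_up: "a \<le> length ps \<Longrightarrow> run (take a ps) (Up 0) (Up a)"
proof (induction a)
  case (Suc a)
  then have "run (take a ps) (Up 0) (Up a)" "run [ps ! a] (Up a) (Up (Suc a))"
    using tr.up[of a] by simp_all
  then have "run (take a ps @ [ps ! a]) (Up 0) (Up (Suc a))" unfolding run_append by blast
  then show ?case using Suc.prems by (simp add: take_Suc_conv_app_nth)
qed simp

lemma run_down:
  "a \<le> length ps \<Longrightarrow> run (rev (take a ps)) (if a = 0 then Up 0 else Down a) (Up 0)"
proof (induction a)
  case (Suc a)
  then show ?case using tr.down[of a] by (auto simp: take_Suc_conv_app_nth)
qed simp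

lemma nonvanishing_unbounded: "\<exists>w\<in>nonvanishing_words I m d. L < length w"
proof -
  obtain X where X: "X \<noteq> []" "X \<in> lists I" "run X (Up (length ps)) (Down (length ps))"
  proof -
    obtain x z where xz: "(x, z) \<in> S" using S_nonempty by auto
    show thesis
    proof (cases z)
      case None
      then show thesis using that[of "[x]"] xz S_I[OF xz] tr.single by auto
    next
      case (Some y)
      then have "run [x, y] (Up (length ps)) (Down (length ps))"
        using xz tr.first tr.second by fastforce
      moreover have "y \<in> I" using S_I S_Some xz Some by blast
      ultimately show thesis using that[of "[x, y]"] S_I[OF xz] by auto
    qed
  qed
  let ?W = "ps @ X @ rev ps"
  have "run ps (Up 0) (Up (length ps))" "run (rev ps) (Down (length ps)) (Up 0)"
    using run_up[of "length ps"] run_down[of "length ps"] ps(1) by simp_all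
  then have W: "run ?W (Up 0) (Up 0)" using X(3) by (auto simp: run_append)
  have "run (concat (replicate n ?W)) (Up 0) (Up 0)" for n
  proof (induction n)
    case (Suc n)
    then show ?case using W unfolding replicate_Suc concat.simps by (subst run_append) blast
  qed simp
  then have "\<not> vanishing I m d (concat (replicate (Suc L) ?W))" by (rule run_imp_nonvanishing)
  moreover have "concat (replicate (Suc L) ?W) \<in> lists I"
    using X(2) ps(3) by (auto simp del: replicate.simps)
  moreover have "L < length (concat (replicate (Suc L) ?W))"
  proof -
    have "length (concat (replicate n ?W)) = n * length ?W" for n by (induction n) auto
    moreover have "Suc L * 1 \<le> Suc L * length ?W"
      using ps(1) by (intro mult_le_mono2) (simp add: Suc_le_eq)
    ultimately show ?thesis by (metis Suc_le_eq mult.right_neutral)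
  qed
  ultimately show ?thesis unfolding nonvanishing_words_def by blast
qed

end

text \<open>Every vertex before the last has all its neighbours on the path. Nothing is asked about
  the neighbours of the last vertex, where the path can still grow.\<close>

definition good_path ::
    "'i set \<Rightarrow> ('i \<Rightarrow> 'i \<Rightarrow> enat) \<Rightarrow> ('i \<Rightarrow> nat) \<Rightarrow> 'i \<Rightarrow> 'i list \<Rightarrow> bool" where
  "good_path I m d i ps \<longleftrightarrow> ps \<noteq> [] \<and> ps ! 0 = i \<and> distinct ps \<and> set ps \<subseteq> I \<and>
     (\<forall>a. Suc a < length ps \<longrightarrow> m (ps ! a) (ps ! Suc a) = 3 \<and> d (ps ! Suc a) = 2 \<and>
       (\<forall>q\<in>I. q \<noteq> ps ! a \<and> 3 \<le> m (ps ! a) q \<longrightarrow> q = ps ! Suc a \<or> (0 < a \<and> q = ps ! (a - 1))))"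

text \<open>Each way in which the extension could fail supplies a middle word for
  \<open>path_automaton\<close>, whose runs contradict the bound on lengths.\<close>

lemma good_path_extend:
  assumes "coxeter_matrix I m" "\<forall>i\<in>I. 2 \<le> d i" "3 \<le> d i"
    and bounded: "\<forall>w\<in>nonvanishing_words I m d. length w \<le> L"
    and good: "good_path I m d i ps"
    and q: "q \<in> I" "q \<notin> set ps" "3 \<le> m (ps ! (length ps - 1)) q"
  shows "good_path I m d i (ps @ [q])"
proof -
  let ?l = "ps ! (length ps - 1)"
  have ps: "ps \<noteq> []" "ps ! 0 = i" "distinct ps" "set ps \<subseteq> I" using good by (auto simp: good_path_def)
  have len: "length ps - 1 < length ps" using ps(1) by simp
  have path: "m (ps ! a) (ps ! Suc a) = 3" if "Suc a < length ps" for a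
    using good that by (auto simp: good_path_def)
  \<comment> \<open>Applied below to the middle words \<open>q\<close> for a label at least 4,
    \<open>q q\<close> for an exponent at least 3, and \<open>q q'\<close> together with
    \<open>q' q\<close> for a second neighbour \<open>q'\<close>.\<close>
  have no_automaton: False
    if S: "S \<noteq> {}" "\<And>x z. (x, z) \<in> S \<Longrightarrow> x \<in> I \<and> x \<noteq> ?l \<and> 3 \<le> m ?l x \<and>
        (2 \<le> length ps \<longrightarrow> x \<noteq> ps ! (length ps - 2))"
      "\<And>x. (x, None) \<in> S \<Longrightarrow> 4 \<le> m ?l x"
      "\<And>x y. (x, Some y) \<in> S \<Longrightarrow> (y, Some x) \<in> S" "\<And>x. (x, Some x) \<in> S \<Longrightarrow> 3 \<le> d x"
    for S
  proof -
    interpret path_automaton I m d ps S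
      using assms(1-3) ps path S by unfold_locales auto
    show False using nonvanishing_unbounded[of L] bounded by fastforce
  qed
  have ql: "q \<noteq> ?l" "2 \<le> length ps \<Longrightarrow> q \<noteq> ps ! (length ps - 2)" using q(2) len by auto
  have mq: "m ?l q = 3"
  proof (rule ccontr)
    assume "m ?l q \<noteq> 3"
    then have "4 \<le> m ?l q" using q(3) by (cases "m ?l q") (auto simp: numeral_eq_enat)
    then show False using no_automaton[of "{(q, None)}"] q ql by auto
  qed
  have dq: "d q = 2"
  proof (rule ccontr)
    assume "d q \<noteq> 2"
    then have "3 \<le> d q" using assms(2) q(1) by fastforce
    then show False using no_automaton[of "{(q, Some q)}"] q ql by auto
  qed
  have nbr: "q' = q \<or> (0 < length ps - 1 \<and> q' = ps ! (length ps - 1 - 1))"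
    if q': "q' \<in> I" "q' \<noteq> ?l" "3 \<le> m ?l q'" for q'
  proof (rule ccontr)
    assume "\<not> ?thesis"
    then have "q' \<noteq> q" "2 \<le> length ps \<Longrightarrow> q' \<noteq> ps ! (length ps - 2)"
      by (auto simp: numeral_2_eq_2)
    then show False using no_automaton[of "{(q, Some q'), (q', Some q)}"] q ql q' by auto
  qed
  have "m ((ps @ [q]) ! a) ((ps @ [q]) ! Suc a) = 3 \<and> d ((ps @ [q]) ! Suc a) = 2 \<and>
       (\<forall>q'\<in>I. q' \<noteq> (ps @ [q]) ! a \<and> 3 \<le> m ((ps @ [q]) ! a) q' \<longrightarrow>
         q' = (ps @ [q]) ! Suc a \<or> (0 < a \<and> q' = (ps @ [q]) ! (a - 1)))"
    if a: "Suc a < length (ps @ [q])" for a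
  proof (cases "Suc a < length ps")
    case True
    moreover have "a - 1 < length ps" using True by simp
    then have "(ps @ [q]) ! (a - 1) = ps ! (a - 1)" by (simp add: nth_append)
    ultimately show ?thesis using good unfolding good_path_def by (simp add: nth_append)
  next
    case False
    then have a': "length ps = Suc a" using a by simp
    then have "(ps @ [q]) ! a = ?l" "(ps @ [q]) ! Suc a = q" "(ps @ [q]) ! (a - 1) = ps ! (a - 1)"
      by (simp_all add: nth_append less_Suc_eq_le)
    then show ?thesis using mq dq nbr a' by simp
  qed
  then show ?thesis
    using ps q(1,2) unfolding good_path_def by (auto simp: nth_append)
qed

text \<open>A walk in the symmetrized graph that starts in \<open>A\<close> never leaves it, and
  connectedness provides walks to all of \<open>I\<close>.\<close>

lemma connected_closed_subset:
  assumes "Digraph_Component.connected (with_proj (coxeter_graph I m))"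
    and "A \<subseteq> I" "A \<noteq> {}"
    and closed: "\<And>a b. a \<in> A \<Longrightarrow> b \<in> I \<Longrightarrow> a \<noteq> b \<Longrightarrow> 3 \<le> m a b \<or> 3 \<le> m b a \<Longrightarrow> b \<in> A"
  shows "A = I"
proof -
  let ?G = "mk_symmetric (with_proj (coxeter_graph I m))"
  have arcs: "arcs_ends (with_proj ?G) \<subseteq>
      {(i, j). i \<in> I \<and> j \<in> I \<and> i \<noteq> j \<and> (3 \<le> m i j \<or> 3 \<le> m j i)}"
    by (auto simp: mk_symmetric_def coxeter_graph_def arcs_ends_conv)
  obtain a where a: "a \<in> A" using assms(3) by blast
  have "b \<in> A" if b: "b \<in> I" for b
  proof -
    have "a \<rightarrow>\<^sup>*\<^bsub>with_proj ?G\<^esub> b"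
      using assms(1,2) a b
      by (auto simp: Digraph_Component.connected_def strongly_connected_def mk_symmetric_def coxeter_graph_def)
    then have "(a, b) \<in> (arcs_ends (with_proj ?G))\<^sup>*" by (rule reachable_rtranclI)
    then show "b \<in> A"
    proof induction
      case (step x y)
      then show ?case using arcs closed by blast
    qed (rule a)
  qed
  then show ?thesis using assms(2) by blast
qed

text \<open>Take a longest good path from \<open>i\<close>. Its earlier vertices have no neighbours
  outside it by definition, its last vertex has none by \<open>good_path_extend\<close> and
  maximality, so by connectedness it exhausts \<open>I\<close>.\<close>

theorem bounded_imp_type_A:
  assumes "coxeter_matrix I m" and "Digraph_Component.connected (with_proj (coxeter_graph I m))"
    and "\<forall>i\<in>I. 2 \<le> d i" and i: "i \<in> I" "3 \<le> d i"
    and bounded: "\<forall>w\<in>nonvanishing_words I m d. length w \<le> L"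
  shows "\<exists>n\<ge>1. \<exists>f. type_A_labelling I m n f \<and> d (f 1) = d i \<and> (\<forall>a\<in>{2..n}. d (f a) = 2)"
proof -
  have fin: "finite I" using assms(1) by (simp add: coxeter_matrix_def)
  have "good_path I m d i [i]" using i by (simp add: good_path_def)
  moreover have "length ps \<le> card I" if "good_path I m d i ps" for ps
    using that fin unfolding good_path_def by (metis card_mono distinct_card)
  ultimately have "\<exists>ps. good_path I m d i ps \<and> (\<forall>qs. good_path I m d i qs \<longrightarrow> length qs \<le> length ps)"
    by (intro ex_has_greatest_nat[of _ "[i]" _ "Suc (card I)"]) (auto simp: less_Suc_eq_le)
  then obtain ps where good: "good_path I m d i ps"
    and maximal: "\<And>qs. good_path I m d i qs \<Longrightarrow> length qs \<le> length ps"
    by blast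
  have ps: "ps \<noteq> []" "ps ! 0 = i" "distinct ps" "set ps \<subseteq> I" using good by (auto simp: good_path_def)
  have sym: "m a b = m b a" if "a \<in> I" "b \<in> I" for a b
    using assms(1) that by (simp add: coxeter_matrix_def)
  have closed: "b \<in> set ps" if ab: "a \<in> set ps" "b \<in> I" "a \<noteq> b" "3 \<le> m a b" for a b
  proof (rule ccontr)
    assume b: "b \<notin> set ps"
    obtain k where k: "k < length ps" "a = ps ! k" using ab(1) by (metis in_set_conv_nth)
    show False
    proof (cases "Suc k < length ps")
      case True
      then have "b = ps ! Suc k \<or> (0 < k \<and> b = ps ! (k - 1))"
        using good ab k unfolding good_path_def by metis
      then show False using b True by auto
    next
      case False
      then have "k = length ps - 1" using k by simp
      then have "good_path I m d i (ps @ [b])"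
        using good_path_extend[OF assms(1,3) i(2) bounded good ab(2) b] ab(4) k by simp
      then show False using maximal by fastforce
    qed
  qed
  have "set ps = I"
    using assms(2) ps(4)
  proof (rule connected_closed_subset)
    show "set ps \<noteq> {}" using ps(1) by simp
    fix a b assume "a \<in> set ps" "b \<in> I" "a \<noteq> b" "3 \<le> m a b \<or> 3 \<le> m b a"
    then show "b \<in> set ps" using closed sym ps(4) by (metis subsetD)
  qed
  \<comment> \<open>The labels run from 1 and list positions from 0, so \<open>f 1\<close> is the
    starting vertex \<open>i\<close>.\<close>
  define n f where "n = length ps" and "f a = ps ! (a - 1)" for a
  have bij: "bij_betw f {1..n} I"
  proof -
    have "bij_betw ((!) ps) {..<n} I"
      unfolding n_def using bij_betw_nth[OF ps(3) HOL.refl] \<open>set ps = I\<close> by simp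
    moreover have "bij_betw (\<lambda>a. a - 1) {1..n} {..<n}"
      by (rule bij_betw_byWitness[where f' = Suc]) auto
    ultimately have "bij_betw ((!) ps \<circ> (\<lambda>a. a - 1)) {1..n} I" by (rule bij_betw_trans[rotated])
    moreover have "(!) ps \<circ> (\<lambda>a. a - 1) = f" by (auto simp: f_def)
    ultimately show ?thesis by simp
  qed
  have ge2: "2 \<le> m a b" if "a \<in> I" "b \<in> I" "a \<noteq> b" for a b
    using assms(1) that by (simp add: coxeter_matrix_def)
  have entry: "m (ps ! a) (ps ! b) = (if b = Suc a then 3 else 2)" if ab: "a < b" "b < n" for a b
  proof -
    have len: "Suc a < length ps" "b < length ps" using ab by (simp_all add: n_def)
    have I: "ps ! a \<in> I" "ps ! b \<in> I" using ps(4) len by auto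
    have ne: "ps ! b \<noteq> ps ! a" using ps(3) len ab by (simp add: nth_eq_iff_index_eq)
    show ?thesis
    proof (cases "b = Suc a")
      case True
      then show ?thesis using good len unfolding good_path_def by simp
    next
      case False
      have "\<not> 3 \<le> m (ps ! a) (ps ! b)"
      proof
        assume "3 \<le> m (ps ! a) (ps ! b)"
        then have "ps ! b = ps ! Suc a \<or> (0 < a \<and> ps ! b = ps ! (a - 1))"
          using good len I ne unfolding good_path_def by blast
        then have "b = Suc a \<or> (0 < a \<and> b = a - 1)"
          using ps(3) len by (auto simp: nth_eq_iff_index_eq)
        then show False using ab False by auto
      qed
      moreover have "2 \<le> m (ps ! a) (ps ! b)" using ge2 I ne by metis
      ultimately have "m (ps ! a) (ps ! b) = 2"
        by (cases "m (ps ! a) (ps ! b)") (auto simp: numeral_eq_enat)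
      then show ?thesis using False by simp
    qed
  qed
  have "type_A_labelling I m n f"
    unfolding type_A_labelling_def
  proof (intro conjI ballI impI)
    show "bij_betw f {1..n} I" by (rule bij)
    fix a b assume ab: "a \<in> {1..n}" "b \<in> {1..n}" "a \<noteq> b"
    show "m (f a) (f b) = (if \<bar>int a - int b\<bar> = 1 then 3 else 2)"
    proof (cases "a < b")
      case True
      then show ?thesis using entry[of "a - 1" "b - 1"] ab by (auto simp: f_def)
    next
      case False
      have "f a \<in> I" "f b \<in> I" using bij ab bij_betw_apply by fast+
      then have "m (f a) (f b) = m (f b) (f a)" by (rule sym)
      then show ?thesis using entry[of "b - 1" "a - 1"] ab False by (auto simp: f_def)
    qed
  qed
  moreover have "d (f a) = 2" if "a \<in> {2..n}" for a
  proof -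
    from that obtain b where "a = 2 + b" by (metis atLeastAtMost_iff le_Suc_ex)
    then have "f a = ps ! Suc b" "Suc b < length ps" using that by (simp_all add: f_def n_def)
    then show ?thesis using good unfolding good_path_def by simp
  qed
  moreover have "d (f 1) = d i" "n \<ge> 1"
    using ps(1,2) by (simp_all add: f_def n_def Suc_leI)
  ultimately show ?thesis by blast
qed

section \<open>The classification\<close>

text \<open>The symmetry of the diagram moves an exceptional exponent from the first vertex to the
  last, where \<open>end_exponent\<close> places it.\<close>

lemma type_A_labelling_reverse:
  assumes "type_A_labelling I m n f"
  shows "type_A_labelling I m n (\<lambda>a. f (n + 1 - a))"
  unfolding type_A_labelling_def
proof (intro conjI ballI impI)
  have "bij_betw (\<lambda>a. n + 1 - a) {1..n} {1..n}"
    by (rule bij_betw_byWitness[where f' = "\<lambda>a. n + 1 - a"]) auto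
  moreover have "bij_betw f {1..n} I" using assms by (simp add: type_A_labelling_def)
  ultimately have "bij_betw (f \<circ> (\<lambda>a. n + 1 - a)) {1..n} I" by (rule bij_betw_trans)
  then show "bij_betw (\<lambda>a. f (n + 1 - a)) {1..n} I" by (simp add: comp_def)
next
  fix a b assume ab: "a \<in> {1..n}" "b \<in> {1..n}" "a \<noteq> b"
  then have "n + 1 - a \<in> {1..n}" "n + 1 - b \<in> {1..n}" "n + 1 - a \<noteq> n + 1 - b" by auto
  then have "m (f (n + 1 - a)) (f (n + 1 - b)) =
      (if \<bar>int (n + 1 - a) - int (n + 1 - b)\<bar> = 1 then 3 else 2)"
    using assms unfolding type_A_labelling_def by blast
  moreover have "\<bar>int (n + 1 - a) - int (n + 1 - b)\<bar> = \<bar>int a - int b\<bar>"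
    using ab by (auto simp: of_nat_diff)
  ultimately show "m (f (n + 1 - a)) (f (n + 1 - b)) = (if \<bar>int a - int b\<bar> = 1 then 3 else 2)"
    by simp
qed

lemma map_upt_eq_iff:
  "map g [1..<n + 1] = xs \<longleftrightarrow> length xs = n \<and> (\<forall>a\<in>{1..n}. g a = xs ! (a - 1))"
proof
  assume "map g [1..<n + 1] = xs"
  then show "length xs = n \<and> (\<forall>a\<in>{1..n}. g a = xs ! (a - 1))"
    by (auto simp: Suc_diff_le simp del: upt_Suc)
next
  assume *: "length xs = n \<and> (\<forall>a\<in>{1..n}. g a = xs ! (a - 1))"
  show "map g [1..<n + 1] = xs"
  proof (rule nth_equalityI)
    fix k assume "k < length (map g [1..<n + 1])"
    then have k: "k < n" by (simp del: upt_Suc)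
    then have "g (Suc k) = xs ! k" using * by (metis Suc_le_eq atLeastAtMost_iff diff_Suc_1 le_add1 plus_1_eq_Suc)
    then show "map g [1..<n + 1] ! k = xs ! k" using k by (simp del: upt_Suc)
  qed (use * in \<open>simp del: upt_Suc\<close>)
qed

theorem theorem1p10:
  fixes I :: "'i set" and m :: "'i \<Rightarrow> 'i \<Rightarrow> enat" and d :: "'i \<Rightarrow> nat"
  assumes "coxeter_matrix I m"
    and "Digraph_Component.connected (with_proj (coxeter_graph I m))"
    and "\<forall>i\<in>I. 2 \<le> d i"
  shows "nil_coxeter_finite_dimensional TYPE('k::field) I (replace_diagonal m d) \<longleftrightarrow>
    (finite (carrier (coxeter_group I m)) \<and> (\<forall>i\<in>I. d i = 2)) \<or>
    (\<exists>n\<ge>1. \<exists>f. type_A_labelling I m n f \<and>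
      (\<exists>D>2. map (\<lambda>a. d (f a)) [1..<n + 1] = replicate (n - 1) 2 @ [D] \<or>
              map (\<lambda>a. d (f a)) [1..<n + 1] = D # replicate (n - 1) 2))"
    (is "?fd \<longleftrightarrow> ?finite \<or> ?typeA")
proof -
  have fd: "?fd \<longleftrightarrow> finite (nonvanishing_words I m d)"
    by (rule finite_dimensional_iff_finite_nonvanishing[OF assms(1,3)])
  have bounded: "finite (nonvanishing_words I m d) \<longleftrightarrow>
      (\<exists>L. \<forall>w\<in>nonvanishing_words I m d. length w \<le> L)"
    using assms(1) by (intro finite_nonvanishing_words_iff) (simp add: coxeter_matrix_def)
  interpret coxeter I m by standard (rule assms(1))
  show ?thesis
  proof
    assume ?fd
    then obtain L where L: "\<forall>w\<in>nonvanishing_words I m d. length w \<le> L" using fd bounded by blast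
    show "?finite \<or> ?typeA"
    proof (cases "\<forall>i\<in>I. d i = 2")
      case True
      then show ?thesis using finite_coxeter_group_iff \<open>?fd\<close> fd by blast
    next
      case False
      then obtain i where i: "i \<in> I" "d i \<noteq> 2" by blast
      then have di: "3 \<le> d i" using assms(3) by fastforce
      obtain n f where n: "n \<ge> 1" and f: "type_A_labelling I m n f"
        and df: "d (f 1) = d i" "\<forall>a\<in>{2..n}. d (f a) = 2"
        using bounded_imp_type_A[OF assms i(1) di L] by blast
      \<comment> \<open>The path starts at the exceptional vertex, so the exponents appear in the
        form with \<open>D\<close> first.\<close>
      have "map (\<lambda>a. d (f a)) [1..<n + 1] = d i # replicate (n - 1) 2"
        unfolding map_upt_eq_iff
      proof (intro conjI ballI)
        fix a assume a: "a \<in> {1..n}"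
        show "d (f a) = (d i # replicate (n - 1) 2) ! (a - 1)"
        proof (cases "a = 1")
          case False
          then obtain b where "a = Suc (Suc b)" using a by (cases a; cases "a - 1") auto
          then show ?thesis using df(2) a by simp
        qed (use df(1) in simp)
      qed (use n in simp)
      then show ?thesis using n f di by (intro disjI2) (metis numeral_3_eq_3 numeral_2_eq_2 Suc_le_eq)
    qed
  next
    assume "?finite \<or> ?typeA"
    then show ?fd
    proof
      assume ?finite
      then show ?fd using finite_coxeter_group_iff fd by blast
    next
      assume ?typeA
      then obtain n f D where n: "n \<ge> 1" and f: "type_A_labelling I m n f" and D: "D > 2"
        and or: "map (\<lambda>a. d (f a)) [1..<n + 1] = replicate (n - 1) 2 @ [D] \<or>
              map (\<lambda>a. d (f a)) [1..<n + 1] = D # replicate (n - 1) 2"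
        by (elim exE conjE) (rule that)
      have "\<exists>L. \<forall>w\<in>nonvanishing_words I m d. length w \<le> L"
        using or
      proof
        assume "map (\<lambda>a. d (f a)) [1..<n + 1] = replicate (n - 1) 2 @ [D]"
        then have eq: "d (f a) = (replicate (n - 1) 2 @ [D]) ! (a - 1)" if "a \<in> {1..n}" for a
          using that unfolding map_upt_eq_iff by blast
        have "d (f a) = end_exponent n D a" if "a \<in> {1..n}" for a
          using eq[OF that] that by (auto simp: nth_append end_exponent_def)
        then show ?thesis using D by (intro type_A_nonvanishing_bounded[OF f, of D]) auto
      next
        assume "map (\<lambda>a. d (f a)) [1..<n + 1] = D # replicate (n - 1) 2"
        then have eq: "d (f a) = (D # replicate (n - 1) 2) ! (a - 1)" if "a \<in> {1..n}" for a
          using that unfolding map_upt_eq_iff by blast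
        have "d (f (n + 1 - a)) = end_exponent n D a" if a: "a \<in> {1..n}" for a
        proof -
          have "n + 1 - a \<in> {1..n}" "n + 1 - a - 1 = n - a" using a by auto
          then have "d (f (n + 1 - a)) = (D # replicate (n - 1) 2) ! (n - a)"
            using eq[of "n + 1 - a"] by simp
          then show ?thesis using a by (auto simp: end_exponent_def nth_Cons')
        qed
        then show ?thesis
          using D by (intro type_A_nonvanishing_bounded[OF type_A_labelling_reverse[OF f], of D]) auto
      qed
      then show ?fd using fd bounded by blast
    qed
  qed
qed

end
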